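(* Let $Q=(Q,\le,\odot,1)$ be a commutative, semicartesian, unital quantale. For each $a\in Q$, the poset $Sub(Q(-,a))$ of subobjects of $Q(-,a)$ in $Sh(Q)$, endowed with the binary operation $*$, is a commutative and semicartesian quantale. Moreover, the poset isomorphism $k_a:[0,a]\to Sub(Q(-,a))$, $q\mapsto [Q(-,q)]_{iso}$ (the class of the unique monomorphism $Q(-,q)\rightarrowtail Q(-,a)$), is an isomorphism of quantales.
   Context: A quantale is a complete lattice $(Q,\le)$ with an associative binary operation $\odot$ satisfying $a\odot\bigvee_i b_i=\bigvee_i(a\odot b_i)$ and $(\bigvee_i b_i)\odot a=\bigvee_i(b_i\odot a)$ for all families. It is commutative if $\odot$ is; semicartesian if $a\odot b\le a$ and $a\odot b\le b$ for all $a,b$; unital if $\odot$ has a two-sided identity $1$ (for semicartesian $Q$, then $1$ is the top element). $0$ denotes the bottom. $Q$ is viewed as a poset category with a unique arrow $v\to u$ iff $v\le u$; $Q(-,v)$ is the representable functor $\mathrm{Hom}_Q(-,v)$ (it is a sheaf). A presheaf on $Q$ is a functor $F:Q^{op}\to Set$; for $v\le u$ and $s\in F(u)$ write $s_{|_v}$ for its restriction in $F(v)$. $F$ is a sheaf if for every $u\in Q$ and every family (possibly empty) with $u=\bigvee_{i\in I}u_i$, and every family $(s_i\in F(u_i))_{i\in I}$ with $s_{i|_{u_i\odot u_j}}=s_{j|_{u_i\odot u_j}}$ for all $i,j\in I$, there is a unique $s\in F(u)$ with $s_{|_{u_i}}=s_i$ for all $i$. $PSh(Q)$ is the category of presheaves,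 and $Sh(Q)$ is its full subcategory of sheaves; morphisms are natural transformations. $Sub(F)$ is the poset of subobjects of $F$ in $Sh(Q)$, i.e. isomorphism classes of monomorphisms into $F$, ordered by factorization. $[0,a]=\{b\in Q: b\le a\}$ has the induced order and multiplication $\odot$. The inclusion $i:Sh(Q)\to PSh(Q)$ has a left adjoint $a$ (sheafification), and $Sh(Q)$ has the monoidal structure $F\otimes G:=a(i(F)\otimes_{Day} i(G))$, where $\otimes_{Day}$ is the Day convolution on $PSh(Q)$ induced by $\odot$; its unit $Q(-,1)$ is terminal, so there are projections $F_0\otimes F_1\to F_0$ and $F_0\otimes F_1\to F_1$. Given monos $\phi_i:F_i\rightarrowtail F$, $i=0,1$, let $F_0\otimes_F F_1\rightarrowtail F_0\otimes F_1$ be the equalizer of the two composites $F_0\otimes F_1\to F_i\xrightarrow{\phi_i}F$, $i=0,1$. The binary operation $*$ on $Sub(F)$ is defined by letting $\phi_0*\phi_1: F_0*F_1\rightarrowtail F$ be the mono in the extremal factorization of $F_0\otimes_F F_1\rightarrowtail F_0\otimes F_1\rightrightarrows F$, i.e. the least subobject of $F$ through which this composite factors. *)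

theory Defs
  imports "HOL-Algebra.Complete_Lattice" "HOL-Library.FuncSet"
begin

section \<open>Quantales\<close>

record 'a quantale_struct = "'a gorder" +
  qmult :: "'a \<Rightarrow> 'a \<Rightarrow> 'a" (infixl \<open>\<odot>\<index>\<close> 70)

text \<open>Every family has the same supremum as its range, so it suffices to distribute over
  subsets \<open>B\<close> of the carrier. A quantale need not have a unit.\<close>

locale quantale = complete_lattice Q for Q :: "('a, 'm) quantale_struct_scheme" (structure) +
  assumes qmult_closed [intro, simp]:
      "\<lbrakk>a \<in> carrier Q; b \<in> carrier Q\<rbrakk> \<Longrightarrow> a \<odot> b \<in> carrier Q"
    and qmult_assoc:
      "\<lbrakk>a \<in> carrier Q; b \<in> carrier Q; c \<in> carrier Q\<rbrakk> \<Longrightarrow> (a \<odot> b) \<odot> c = a \<odot> (b \<odot> c)"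
    and qmult_sup_right:
      "\<lbrakk>a \<in> carrier Q; B \<subseteq> carrier Q\<rbrakk> \<Longrightarrow> a \<odot> (\<Squnion> B) = \<Squnion> ((\<lambda>b. a \<odot> b) ` B)"
    and qmult_sup_left:
      "\<lbrakk>a \<in> carrier Q; B \<subseteq> carrier Q\<rbrakk> \<Longrightarrow> (\<Squnion> B) \<odot> a = \<Squnion> ((\<lambda>b. b \<odot> a) ` B)"

definition commutative_quantale :: "('a, 'm) quantale_struct_scheme \<Rightarrow> bool" where
  "commutative_quantale Q \<longleftrightarrow> quantale Q \<and>
     (\<forall>a\<in>carrier Q. \<forall>b\<in>carrier Q. a \<odot>\<^bsub>Q\<^esub> b = b \<odot>\<^bsub>Q\<^esub> a)"

definition semicartesian_quantale :: "('a, 'm) quantale_struct_scheme \<Rightarrow> bool" where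
  "semicartesian_quantale Q \<longleftrightarrow> quantale Q \<and>
     (\<forall>a\<in>carrier Q. \<forall>b\<in>carrier Q.
        a \<odot>\<^bsub>Q\<^esub> b \<sqsubseteq>\<^bsub>Q\<^esub> a \<and> a \<odot>\<^bsub>Q\<^esub> b \<sqsubseteq>\<^bsub>Q\<^esub> b)"

definition unital_quantale :: "('a, 'm) quantale_struct_scheme \<Rightarrow> bool" where
  "unital_quantale Q \<longleftrightarrow> quantale Q \<and>
     (\<exists>e\<in>carrier Q. \<forall>a\<in>carrier Q. e \<odot>\<^bsub>Q\<^esub> a = a \<and> a \<odot>\<^bsub>Q\<^esub> e = a)"

definition quantale_hom ::
  "('a, 'm) quantale_struct_scheme \<Rightarrow> ('b, 'n) quantale_struct_scheme \<Rightarrow> ('a \<Rightarrow> 'b) \<Rightarrow> bool" where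
  "quantale_hom P R f \<longleftrightarrow> quantale P \<and> quantale R \<and> f \<in> carrier P \<rightarrow> carrier R \<and>
     (\<forall>A. A \<subseteq> carrier P \<longrightarrow> f (\<Squnion>\<^bsub>P\<^esub> A) = \<Squnion>\<^bsub>R\<^esub> (f ` A)) \<and>
     (\<forall>x\<in>carrier P. \<forall>y\<in>carrier P. f (x \<odot>\<^bsub>P\<^esub> y) = f x \<odot>\<^bsub>R\<^esub> f y)"

definition quantale_iso ::
  "('a, 'm) quantale_struct_scheme \<Rightarrow> ('b, 'n) quantale_struct_scheme \<Rightarrow> ('a \<Rightarrow> 'b) \<Rightarrow> bool" where
  "quantale_iso P R f \<longleftrightarrow> bij_betw f (carrier P) (carrier R) \<and>
     quantale_hom P R f \<and> quantale_hom R P (inv_into (carrier P) f)"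

definition poset_iso :: "('a, 'm) gorder_scheme \<Rightarrow> ('b, 'n) gorder_scheme \<Rightarrow> ('a \<Rightarrow> 'b) \<Rightarrow> bool" where
  "poset_iso P R f \<longleftrightarrow> partial_order P \<and> partial_order R \<and>
     bij_betw f (carrier P) (carrier R) \<and>
     (\<forall>x\<in>carrier P. \<forall>y\<in>carrier P. x \<sqsubseteq>\<^bsub>P\<^esub> y \<longleftrightarrow> f x \<sqsubseteq>\<^bsub>R\<^esub> f y)"

definition down_interval :: "('a, 'm) quantale_struct_scheme \<Rightarrow> 'a \<Rightarrow> 'a quantale_struct" where
  "down_interval Q a =
     \<lparr>carrier = {b \<in> carrier Q. b \<sqsubseteq>\<^bsub>Q\<^esub> a}, eq = (=), le = le Q, qmult = qmult Q\<rparr>"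


section \<open>Presheaves and sheaves\<close>

text \<open>The universe of sets is the collection of sets with elements in a fixed but arbitrary
  type. \<open>sec F u\<close> is the set \<open>F(u)\<close> and \<open>res F u v\<close> is the restriction
  \<open>F(u) \<rightarrow> F(v)\<close>, which is meaningful for \<open>v \<sqsubseteq> u\<close> in the carrier and on \<open>F(u)\<close> only. Likewise
  only the values of a natural transformation on sections matter, so natural transformations
  are compared by \<open>nat_eq\<close>.\<close>

record ('q, 's) psh =
  sec :: "'q \<Rightarrow> 's set"
  res :: "'q \<Rightarrow> 'q \<Rightarrow> 's \<Rightarrow> 's"

definition is_presheaf :: "('q, 'm) quantale_struct_scheme \<Rightarrow> ('q, 's) psh \<Rightarrow> bool" where
  "is_presheaf Q F \<longleftrightarrow>
     (\<forall>u\<in>carrier Q. \<forall>v\<in>carrier Q. v \<sqsubseteq>\<^bsub>Q\<^esub> u \<longrightarrow> res F u v \<in> sec F u \<rightarrow> sec F v) \<and>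
     (\<forall>u\<in>carrier Q. \<forall>x\<in>sec F u. res F u u x = x) \<and>
     (\<forall>u\<in>carrier Q. \<forall>v\<in>carrier Q. \<forall>w\<in>carrier Q. w \<sqsubseteq>\<^bsub>Q\<^esub> v \<and> v \<sqsubseteq>\<^bsub>Q\<^esub> u \<longrightarrow>
        (\<forall>x\<in>sec F u. res F v w (res F u v x) = res F u w x))"

definition compatible ::
  "('q, 'm) quantale_struct_scheme \<Rightarrow> ('q, 's) psh \<Rightarrow> 'i set \<Rightarrow> ('i \<Rightarrow> 'q) \<Rightarrow> ('i \<Rightarrow> 's) \<Rightarrow> bool" where
  "compatible Q F I U s \<longleftrightarrow>
     (\<forall>i\<in>I. U i \<in> carrier Q \<and> s i \<in> sec F (U i)) \<and>
     (\<forall>i\<in>I. \<forall>j\<in>I. res F (U i) (U i \<odot>\<^bsub>Q\<^esub> U j) (s i) = res F (U j) (U i \<odot>\<^bsub>Q\<^esub> U j) (s j))"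

definition glues ::
  "('q, 'm) quantale_struct_scheme \<Rightarrow> ('q, 's) psh \<Rightarrow> 'i set \<Rightarrow> ('i \<Rightarrow> 'q) \<Rightarrow> ('i \<Rightarrow> 's) \<Rightarrow> 's \<Rightarrow> bool" where
  "glues Q F I U s z \<longleftrightarrow> z \<in> sec F (\<Squnion>\<^bsub>Q\<^esub> (U ` I)) \<and>
     (\<forall>i\<in>I. res F (\<Squnion>\<^bsub>Q\<^esub> (U ` I)) (U i) z = s i)"

text \<open>Index sets are subsets of \<open>'q \<times> 's\<close>. This is no restriction, since an arbitrary family
  \<open>(u\<^sub>i, s\<^sub>i)\<close> may be reindexed by the set of pairs \<open>(u\<^sub>i, s\<^sub>i)\<close>; see \<open>sheaf_any_index\<close>. Note that
  \<open>u\<^sub>i = u\<^sub>j\<close> with \<open>s\<^sub>i \<noteq> s\<^sub>j\<close> must be allowed, because \<open>u \<odot> u\<close> may be smaller than \<open>u\<close>.\<close>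

definition is_sheaf :: "('q, 'm) quantale_struct_scheme \<Rightarrow> ('q, 's) psh \<Rightarrow> bool" where
  "is_sheaf Q F \<longleftrightarrow> is_presheaf Q F \<and>
     (\<forall>(I :: ('q \<times> 's) set) U s. compatible Q F I U s \<longrightarrow> (\<exists>!z. glues Q F I U s z))"

lemma sheaf_any_index:
  fixes I :: "'i set" and F :: "('q, 's) psh"
  assumes "is_sheaf Q F" "compatible Q F I U s"
  shows "\<exists>!z. glues Q F I U s z"
proof -
  let ?J = "(\<lambda>i. (U i, s i)) ` I"
  have "compatible Q F ?J fst snd"
    using assms(2) unfolding compatible_def by auto
  then have "\<exists>!z. glues Q F ?J fst snd z"
    using assms(1) unfolding is_sheaf_def by blast
  moreover have "glues Q F ?J fst snd z \<longleftrightarrow> glues Q F I U s z" for z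
    unfolding glues_def by (simp add: image_image)
  ultimately show ?thesis by simp
qed

definition nat_trans ::
  "('q, 'm) quantale_struct_scheme \<Rightarrow> ('q, 's) psh \<Rightarrow> ('q, 't) psh \<Rightarrow> ('q \<Rightarrow> 's \<Rightarrow> 't) \<Rightarrow> bool" where
  "nat_trans Q F G f \<longleftrightarrow>
     (\<forall>u\<in>carrier Q. f u \<in> sec F u \<rightarrow> sec G u) \<and>
     (\<forall>u\<in>carrier Q. \<forall>v\<in>carrier Q. v \<sqsubseteq>\<^bsub>Q\<^esub> u \<longrightarrow>
        (\<forall>x\<in>sec F u. f v (res F u v x) = res G u v (f u x)))"

definition nat_eq ::
  "('q, 'm) quantale_struct_scheme \<Rightarrow> ('q, 's) psh \<Rightarrow> ('q \<Rightarrow> 's \<Rightarrow> 't) \<Rightarrow> ('q \<Rightarrow> 's \<Rightarrow> 't) \<Rightarrow> bool" where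
  "nat_eq Q F f g \<longleftrightarrow> (\<forall>u\<in>carrier Q. \<forall>x\<in>sec F u. f u x = g u x)"

text \<open>\<open>arr v u\<close> names the unique arrow \<open>v \<rightarrow> u\<close> of the poset category of \<open>Q\<close>. Hence
  \<open>representable Q arr u\<close> is \<open>Q(-, u)\<close>, with restriction given by precomposition, and for
  \<open>q \<sqsubseteq> a\<close> the unique natural transformation \<open>Q(-, q) \<rightarrow> Q(-, a)\<close> is postcomposition with
  \<open>q \<rightarrow> a\<close>.\<close>

definition representable ::
  "('q, 'm) quantale_struct_scheme \<Rightarrow> ('q \<Rightarrow> 'q \<Rightarrow> 'u) \<Rightarrow> 'q \<Rightarrow> ('q, 'u) psh" where
  "representable Q arr u =
     \<lparr>sec = (\<lambda>v. {f. f = arr v u \<and> v \<in> carrier Q \<and> v \<sqsubseteq>\<^bsub>Q\<^esub> u}), res = (\<lambda>v w _. arr w u)\<rparr>"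

definition representable_map :: "('q \<Rightarrow> 'q \<Rightarrow> 'u) \<Rightarrow> 'q \<Rightarrow> 'q \<Rightarrow> 'u \<Rightarrow> 'u" where
  "representable_map arr a = (\<lambda>v _. arr v a)"

lemma presheaf_res_closed:
  "\<lbrakk>is_presheaf Q F; u \<in> carrier Q; v \<in> carrier Q; v \<sqsubseteq>\<^bsub>Q\<^esub> u; x \<in> sec F u\<rbrakk> \<Longrightarrow>
    res F u v x \<in> sec F v"
  unfolding is_presheaf_def by blast

lemma presheaf_res_id: "\<lbrakk>is_presheaf Q F; u \<in> carrier Q; x \<in> sec F u\<rbrakk> \<Longrightarrow> res F u u x = x"
  unfolding is_presheaf_def by blast

lemma presheaf_res_comp:
  "\<lbrakk>is_presheaf Q F; u \<in> carrier Q; v \<in> carrier Q; w \<in> carrier Q;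
    v \<sqsubseteq>\<^bsub>Q\<^esub> u; w \<sqsubseteq>\<^bsub>Q\<^esub> v; x \<in> sec F u\<rbrakk> \<Longrightarrow> res F v w (res F u v x) = res F u w x"
  unfolding is_presheaf_def by blast

lemma representable_is_sheaf:
  assumes "semicartesian_quantale Q" "u \<in> carrier Q"
  shows "is_sheaf Q (representable Q arr u)"
proof -
  interpret quantale Q using assms(1) by (simp add: semicartesian_quantale_def)
  have p: "is_presheaf Q (representable Q arr u)"
    unfolding is_presheaf_def representable_def using assms(2) by (auto intro: le_trans)
  show ?thesis unfolding is_sheaf_def
  proof (intro conjI p allI impI)
    fix I :: "('a \<times> 'c) set" and U s
    assume c: "compatible Q (representable Q arr u) I U s"
    then have U: "U ` I \<subseteq> carrier Q" and le: "\<And>i. i \<in> I \<Longrightarrow> U i \<sqsubseteq>\<^bsub>Q\<^esub> u"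
      and s: "\<And>i. i \<in> I \<Longrightarrow> s i = arr (U i) u"
      unfolding compatible_def representable_def by auto
    have "\<Squnion>\<^bsub>Q\<^esub> (U ` I) \<sqsubseteq>\<^bsub>Q\<^esub> u" using U le assms(2) by (intro sup_least) auto
    then show "\<exists>!z. glues Q (representable Q arr u) I U s z"
      unfolding glues_def representable_def using U s by auto
  qed
qed


section \<open>The poset of subobjects of a sheaf\<close>

definition sheaf_mono ::
  "('q, 'm) quantale_struct_scheme \<Rightarrow> ('q, 't) psh \<Rightarrow> ('q, 's) psh \<Rightarrow> ('q \<Rightarrow> 't \<Rightarrow> 's) \<Rightarrow> bool" where
  "sheaf_mono Q G F \<phi> \<longleftrightarrow> is_sheaf Q G \<and> is_sheaf Q F \<and> nat_trans Q G F \<phi> \<and>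
     (\<forall>(H :: ('q, 't) psh) g h.
        is_sheaf Q H \<and> nat_trans Q H G g \<and> nat_trans Q H G h \<and>
        nat_eq Q H (\<lambda>u. \<phi> u \<circ> g u) (\<lambda>u. \<phi> u \<circ> h u) \<longrightarrow> nat_eq Q H g h)"

text \<open>Monomorphisms in the category of sheaves are the sectionwise injective natural
  transformations, so being a monomorphism does not depend on the universe of the test objects,
  and every monomorphism into \<open>F\<close> from a sheaf with values in some other type is isomorphic over
  \<open>F\<close> to its image, which has values in the type of \<open>F\<close>. It is therefore no restriction that
  \<open>mono_into\<close> only admits domains with values in the type of \<open>F\<close>.\<close>

lemma sheaf_mono_iff_inj:
  fixes G :: "('q, 't) psh"
  assumes Q: "semicartesian_quantale Q"
  shows "sheaf_mono Q G F \<phi> \<longleftrightarrow> is_sheaf Q G \<and> is_sheaf Q F \<and> nat_trans Q G F \<phi> \<and>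
    (\<forall>u\<in>carrier Q. inj_on (\<phi> u) (sec G u))"
proof
  assume m: "sheaf_mono Q G F \<phi>"
  then have G: "is_presheaf Q G" and nat: "nat_trans Q G F \<phi>"
    unfolding sheaf_mono_def is_sheaf_def by auto
  interpret quantale Q using Q by (simp add: semicartesian_quantale_def)
  have "x = y" if u: "u \<in> carrier Q" and x: "x \<in> sec G u" and y: "y \<in> sec G u" and eq: "\<phi> u x = \<phi> u y"
    for u x y
  proof -
    define H where "H = representable Q (\<lambda>_ _. undefined :: 't) u"
    have H: "is_sheaf Q H" unfolding H_def using representable_is_sheaf[OF Q u] .
    have nt: "nat_trans Q H G (\<lambda>v _. res G u v z)" if "z \<in> sec G u" for z
      using G u that unfolding H_def nat_trans_def is_presheaf_def representable_def
      by (auto simp: Pi_iff)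
    have "nat_eq Q H (\<lambda>v. \<phi> v \<circ> (\<lambda>_. res G u v x)) (\<lambda>v. \<phi> v \<circ> (\<lambda>_. res G u v y))"
      using nat u x y eq unfolding H_def nat_eq_def nat_trans_def representable_def by auto
    then have "nat_eq Q H (\<lambda>v _. res G u v x) (\<lambda>v _. res G u v y)"
      using m H nt[OF x] nt[OF y] unfolding sheaf_mono_def by blast
    then have "res G u u x = res G u u y"
      using u unfolding H_def nat_eq_def representable_def by auto
    then show ?thesis using G u x y unfolding is_presheaf_def by metis
  qed
  then show "is_sheaf Q G \<and> is_sheaf Q F \<and> nat_trans Q G F \<phi> \<and>
    (\<forall>u\<in>carrier Q. inj_on (\<phi> u) (sec G u))"
    using m unfolding sheaf_mono_def inj_on_def by blast
next
  assume "is_sheaf Q G \<and> is_sheaf Q F \<and> nat_trans Q G F \<phi> \<and>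
    (\<forall>u\<in>carrier Q. inj_on (\<phi> u) (sec G u))"
  then show "sheaf_mono Q G F \<phi>"
    unfolding sheaf_mono_def nat_eq_def nat_trans_def inj_on_def by (auto simp: Pi_iff)
qed

type_synonym ('q, 'u) mono_into = "('q, 'u) psh \<times> ('q \<Rightarrow> 'u \<Rightarrow> 'u)"

definition monos_into :: "('q, 'm) quantale_struct_scheme \<Rightarrow> ('q, 'u) psh \<Rightarrow> ('q, 'u) mono_into set" where
  "monos_into Q F = {(G, \<phi>). sheaf_mono Q G F \<phi>}"

definition mono_iso ::
  "('q, 'm) quantale_struct_scheme \<Rightarrow> ('q, 'u) psh \<Rightarrow> ('q, 'u) mono_into rel" where
  "mono_iso Q F = {((G, \<phi>), (H, \<psi>)).
     (G, \<phi>) \<in> monos_into Q F \<and> (H, \<psi>) \<in> monos_into Q F \<and>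
     (\<exists>g h. nat_trans Q G H g \<and> nat_trans Q H G h \<and>
        nat_eq Q G (\<lambda>u. h u \<circ> g u) (\<lambda>u x. x) \<and> nat_eq Q H (\<lambda>u. g u \<circ> h u) (\<lambda>u x. x) \<and>
        nat_eq Q G (\<lambda>u. \<psi> u \<circ> g u) \<phi>)}"

definition Sub :: "('q, 'm) quantale_struct_scheme \<Rightarrow> ('q, 'u) psh \<Rightarrow> ('q, 'u) mono_into set set" where
  "Sub Q F = monos_into Q F // mono_iso Q F"

definition factors_through ::
  "('q, 'm) quantale_struct_scheme \<Rightarrow> ('q, 't) psh \<Rightarrow> ('q \<Rightarrow> 't \<Rightarrow> 'u) \<Rightarrow> ('q, 'u) mono_into \<Rightarrow> bool" where
  "factors_through Q E f m \<longleftrightarrow>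
     (\<exists>g. nat_trans Q E (fst m) g \<and> nat_eq Q E (\<lambda>u. snd m u \<circ> g u) f)"

definition sub_le ::
  "('q, 'm) quantale_struct_scheme \<Rightarrow> ('q, 'u) mono_into set \<Rightarrow> ('q, 'u) mono_into set \<Rightarrow> bool" where
  "sub_le Q A B \<longleftrightarrow> (\<exists>(G, \<phi>)\<in>A. \<exists>m\<in>B. factors_through Q G \<phi> m)"


section \<open>Day convolution\<close>

text \<open>The coend \<open>(F \<otimes>\<^bsub>Day\<^esub> G)(w) = \<integral>\<^bsup>u,v\<^esup> Q(w, u \<odot> v) \<times> F(u) \<times> G(v)\<close>, as the quotient of the set of
  all \<open>(u, v, x, y)\<close> with \<open>w \<sqsubseteq> u \<odot> v\<close>, \<open>x \<in> F(u)\<close>, \<open>y \<in> G(v)\<close> by the equivalence relation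
  generated by \<open>(u, v, x, y) \<sim> (u', v', x|u', y|v')\<close> for \<open>u' \<sqsubseteq> u\<close>, \<open>v' \<sqsubseteq> v\<close>, \<open>w \<sqsubseteq> u' \<odot> v'\<close>.\<close>

definition day_elts ::
  "('q, 'm) quantale_struct_scheme \<Rightarrow> ('q, 's) psh \<Rightarrow> ('q, 't) psh \<Rightarrow> 'q \<Rightarrow> ('q \<times> 'q \<times> 's \<times> 't) set" where
  "day_elts Q F G w = {(u, v, x, y). w \<in> carrier Q \<and> u \<in> carrier Q \<and> v \<in> carrier Q \<and>
     w \<sqsubseteq>\<^bsub>Q\<^esub> u \<odot>\<^bsub>Q\<^esub> v \<and> x \<in> sec F u \<and> y \<in> sec G v}"

definition day_step ::
  "('q, 'm) quantale_struct_scheme \<Rightarrow> ('q, 's) psh \<Rightarrow> ('q, 't) psh \<Rightarrow> 'q \<Rightarrow> ('q \<times> 'q \<times> 's \<times> 't) rel" where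
  "day_step Q F G w = {((u, v, x, y), (u', v', res F u u' x, res G v v' y)) | u v x y u' v'.
     (u, v, x, y) \<in> day_elts Q F G w \<and> u' \<in> carrier Q \<and> v' \<in> carrier Q \<and>
     u' \<sqsubseteq>\<^bsub>Q\<^esub> u \<and> v' \<sqsubseteq>\<^bsub>Q\<^esub> v \<and> w \<sqsubseteq>\<^bsub>Q\<^esub> u' \<odot>\<^bsub>Q\<^esub> v'}"

definition day_eq ::
  "('q, 'm) quantale_struct_scheme \<Rightarrow> ('q, 's) psh \<Rightarrow> ('q, 't) psh \<Rightarrow> 'q \<Rightarrow> ('q \<times> 'q \<times> 's \<times> 't) rel" where
  "day_eq Q F G w = (day_step Q F G w \<union> (day_step Q F G w)\<inverse>)\<^sup>*"

definition day_conv ::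
  "('q, 'm) quantale_struct_scheme \<Rightarrow> ('q, 's) psh \<Rightarrow> ('q, 't) psh \<Rightarrow> ('q, ('q \<times> 'q \<times> 's \<times> 't) set) psh" where
  "day_conv Q F G =
     \<lparr>sec = (\<lambda>w. day_elts Q F G w // day_eq Q F G w),
      res = (\<lambda>w w' C. day_eq Q F G w' `` C)\<rparr>"

text \<open>The composites \<open>F \<otimes>\<^bsub>Day\<^esub> G \<rightarrow> F \<otimes>\<^bsub>Day\<^esub> Q(-, 1) \<cong> F\<close> and \<open>F \<otimes>\<^bsub>Day\<^esub> G \<rightarrow> Q(-, 1) \<otimes>\<^bsub>Day\<^esub> G \<cong> G\<close>,
  where the first arrows are induced by the maps to the terminal unit and the second ones are the
  unitors. They send the class of \<open>(u, v, x, y)\<close> at \<open>w\<close> to \<open>x|w\<close> and \<open>y|w\<close>, where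
  \<open>w \<sqsubseteq> u \<odot> v \<sqsubseteq> u, v\<close>.\<close>

definition day_fst ::
  "('q, 's) psh \<Rightarrow> 'q \<Rightarrow> ('q \<times> 'q \<times> 's \<times> 't) set \<Rightarrow> 's" where
  "day_fst F w C = the_elem ((\<lambda>(u, v, x, y). res F u w x) ` C)"

definition day_snd ::
  "('q, 't) psh \<Rightarrow> 'q \<Rightarrow> ('q \<times> 'q \<times> 's \<times> 't) set \<Rightarrow> 't" where
  "day_snd G w C = the_elem ((\<lambda>(u, v, x, y). res G v w y) ` C)"

lemma day_elts_step:
  assumes "is_presheaf Q F" "is_presheaf Q G" "(e, e') \<in> day_step Q F G w"
  shows "e \<in> day_elts Q F G w" "e' \<in> day_elts Q F G w"
  using assms unfolding day_step_def day_elts_def is_presheaf_def by (auto simp: Pi_iff)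

lemma day_eq_elts:
  assumes "is_presheaf Q F" "is_presheaf Q G" "(e, e') \<in> day_eq Q F G w" "e \<in> day_elts Q F G w"
  shows "e' \<in> day_elts Q F G w"
  using assms(3) unfolding day_eq_def
  by (induction rule: rtrancl_induct) (use assms(4) day_elts_step[OF assms(1,2)] in blast)+

lemma day_eq_equiv: "equiv UNIV (day_eq Q F G w)"
  unfolding day_eq_def
  by (intro equivI refl_rtrancl sym_rtrancl trans_rtrancl) (auto simp: sym_def refl_on_def)

lemma day_stepI:
  assumes "(u, v, x, y) \<in> day_elts Q F G w" "u' \<in> carrier Q" "v' \<in> carrier Q"
    "u' \<sqsubseteq>\<^bsub>Q\<^esub> u" "v' \<sqsubseteq>\<^bsub>Q\<^esub> v" "w \<sqsubseteq>\<^bsub>Q\<^esub> u' \<odot>\<^bsub>Q\<^esub> v'"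
  shows "((u, v, x, y), (u', v', res F u u' x, res G v v' y)) \<in> day_step Q F G w"
  unfolding day_step_def using assms by blast

lemma day_stepE:
  assumes "(d, d') \<in> day_step Q F G w"
  obtains u v x y u' v' where "d = (u, v, x, y)" "d' = (u', v', res F u u' x, res G v v' y)"
    "(u, v, x, y) \<in> day_elts Q F G w" "u' \<in> carrier Q" "v' \<in> carrier Q"
    "u' \<sqsubseteq>\<^bsub>Q\<^esub> u" "v' \<sqsubseteq>\<^bsub>Q\<^esub> v" "w \<sqsubseteq>\<^bsub>Q\<^esub> u' \<odot>\<^bsub>Q\<^esub> v'"
  using assms unfolding day_step_def by blast

lemma day_eq_common:
  assumes "(d, e) \<in> day_step Q F G w" "(d, e') \<in> day_step Q F G w"
  shows "(e, e') \<in> day_eq Q F G w"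
proof -
  let ?R = "day_step Q F G w \<union> (day_step Q F G w)\<inverse>"
  have "(e, d) \<in> ?R\<^sup>*" "(d, e') \<in> ?R\<^sup>*" using assms by auto
  then show ?thesis unfolding day_eq_def by (rule rtrancl_trans)
qed

lemma day_step_mono:
  assumes "quantale Q" "w \<in> carrier Q" "w' \<in> carrier Q" "w' \<sqsubseteq>\<^bsub>Q\<^esub> w"
  shows "day_elts Q F G w \<subseteq> day_elts Q F G w'" "day_eq Q F G w \<subseteq> day_eq Q F G w'"
proof -
  interpret quantale Q by fact
  show e: "day_elts Q F G w \<subseteq> day_elts Q F G w'"
    unfolding day_elts_def using assms(2-4) by (auto intro: le_trans)
  have "day_step Q F G w \<subseteq> day_step Q F G w'"
    unfolding day_step_def using e assms(2-4)
    by (clarsimp, blast intro: le_trans qmult_closed)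
  then show "day_eq Q F G w \<subseteq> day_eq Q F G w'"
    unfolding day_eq_def by (intro rtrancl_mono) auto
qed

lemma day_res_class:
  assumes "quantale Q" "w \<in> carrier Q" "w' \<in> carrier Q" "w' \<sqsubseteq>\<^bsub>Q\<^esub> w"
  shows "day_eq Q F G w' `` (day_eq Q F G w `` {e}) = day_eq Q F G w' `` {e}"
proof -
  have "day_eq Q F G w \<subseteq> day_eq Q F G w'" using day_step_mono(2)[OF assms] .
  then show ?thesis
    unfolding day_eq_def by (blast intro: rtrancl_trans)
qed

lemma day_conv_is_presheaf:
  assumes "quantale Q"
  shows "is_presheaf Q (day_conv Q F G)"
proof -
  interpret quantale Q by fact
  show ?thesis
    unfolding is_presheaf_def
  proof (intro conjI ballI impI)
    fix u v assume uv: "u \<in> carrier Q" "v \<in> carrier Q" "v \<sqsubseteq>\<^bsub>Q\<^esub> u"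
    show "res (day_conv Q F G) u v \<in> sec (day_conv Q F G) u \<rightarrow> sec (day_conv Q F G) v"
    proof
      fix C assume "C \<in> sec (day_conv Q F G) u"
      then obtain e where e: "e \<in> day_elts Q F G u" "C = day_eq Q F G u `` {e}"
        by (auto simp: day_conv_def elim: quotientE)
      then have "e \<in> day_elts Q F G v" using day_step_mono(1)[OF assms uv] by blast
      then show "res (day_conv Q F G) u v C \<in> sec (day_conv Q F G) v"
        unfolding e(2) day_conv_def by (simp add: day_res_class[OF assms uv] quotientI)
    qed
  next
    fix u C assume u: "u \<in> carrier Q" and "C \<in> sec (day_conv Q F G) u"
    then obtain e where e: "e \<in> day_elts Q F G u" "C = day_eq Q F G u `` {e}"
      by (auto simp: day_conv_def elim: quotientE)
    show "res (day_conv Q F G) u u C = C"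
      unfolding e(2) day_conv_def by (simp add: day_res_class[OF assms u u le_refl[OF u]])
  next
    fix u v w C
    assume u: "u \<in> carrier Q" and v: "v \<in> carrier Q" and w: "w \<in> carrier Q"
      and le: "w \<sqsubseteq>\<^bsub>Q\<^esub> v \<and> v \<sqsubseteq>\<^bsub>Q\<^esub> u" and "C \<in> sec (day_conv Q F G) u"
    then obtain e where e: "e \<in> day_elts Q F G u" "C = day_eq Q F G u `` {e}"
      by (auto simp: day_conv_def elim: quotientE)
    have "w \<sqsubseteq>\<^bsub>Q\<^esub> u" using le_trans[of w v u] le u v w by simp
    then show "res (day_conv Q F G) v w (res (day_conv Q F G) u v C) = res (day_conv Q F G) u w C"
      unfolding e(2) day_conv_def using le u v w by (simp add: day_res_class[OF assms])
  qed
qed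

lemma image_singletonI: "\<lbrakk>s \<in> S; \<And>d. d \<in> S \<Longrightarrow> f d = f s\<rbrakk> \<Longrightarrow> f ` S = {f s}"
  by blast

lemma day_fst_class:
  assumes Q: "semicartesian_quantale Q" and F: "is_presheaf Q F" and G: "is_presheaf Q G"
    and e: "(u, v, x, y) \<in> day_elts Q F G w"
  shows "day_fst F w (day_eq Q F G w `` {(u, v, x, y)}) = res F u w x"
    and "day_snd G w (day_eq Q F G w `` {(u, v, x, y)}) = res G v w y"
proof -
  interpret quantale Q using Q by (simp add: semicartesian_quantale_def)
  let ?p = "\<lambda>(u, v, x, y). res F u w x" and ?q = "\<lambda>(u, v, x, y). res G v w y"
  have le: "w \<sqsubseteq>\<^bsub>Q\<^esub> u \<and> w \<sqsubseteq>\<^bsub>Q\<^esub> v"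
    if "w \<in> carrier Q" "u \<in> carrier Q" "v \<in> carrier Q" "w \<sqsubseteq>\<^bsub>Q\<^esub> u \<odot>\<^bsub>Q\<^esub> v" for u v
    using Q that le_trans[of w "u \<odot>\<^bsub>Q\<^esub> v"] unfolding semicartesian_quantale_def by simp
  have step: "?p d = ?p d' \<and> ?q d = ?q d'" if st: "(d, d') \<in> day_step Q F G w" for d d'
  proof -
    obtain u v x y u' v' where d: "d = (u, v, x, y)" "d' = (u', v', res F u u' x, res G v v' y)"
      and m: "(u, v, x, y) \<in> day_elts Q F G w" "u' \<in> carrier Q" "v' \<in> carrier Q"
        "u' \<sqsubseteq>\<^bsub>Q\<^esub> u" "v' \<sqsubseteq>\<^bsub>Q\<^esub> v" "w \<sqsubseteq>\<^bsub>Q\<^esub> u' \<odot>\<^bsub>Q\<^esub> v'"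
      using st by (rule day_stepE)
    have c: "w \<in> carrier Q" "u \<in> carrier Q" "v \<in> carrier Q" "x \<in> sec F u" "y \<in> sec G v"
      using m(1) unfolding day_elts_def by simp_all
    have "w \<sqsubseteq>\<^bsub>Q\<^esub> u'" "w \<sqsubseteq>\<^bsub>Q\<^esub> v'" using le[OF c(1) m(2,3,6)] by simp_all
    then have "res F u' w (res F u u' x) = res F u w x" "res G v' w (res G v v' y) = res G v w y"
      by (simp_all add: presheaf_res_comp[OF F c(2) m(2) c(1) m(4) _ c(4)]
          presheaf_res_comp[OF G c(3) m(3) c(1) m(5) _ c(5)])
    then show ?thesis by (simp add: d)
  qed
  have inv: "?p d = ?p e \<and> ?q d = ?q e" if "(e, d) \<in> day_eq Q F G w" for d e
    using that unfolding day_eq_def by (induction rule: rtrancl_induct) (use step in fastforce)+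
  let ?S = "day_eq Q F G w `` {(u, v, x, y)}"
  have "(u, v, x, y) \<in> ?S" by (simp add: day_eq_def)
  then have "?p ` ?S = {?p (u, v, x, y)}" "?q ` ?S = {?q (u, v, x, y)}"
    by (rule image_singletonI; use inv in blast)+
  then show "day_fst F w (day_eq Q F G w `` {(u, v, x, y)}) = res F u w x"
    and "day_snd G w (day_eq Q F G w `` {(u, v, x, y)}) = res G v w y"
    unfolding day_fst_def day_snd_def by simp_all
qed

lemma day_projections_nat_trans:
  assumes Q: "semicartesian_quantale Q" and F: "is_presheaf Q F" and G: "is_presheaf Q G"
  shows "nat_trans Q (day_conv Q F G) F (day_fst F)" "nat_trans Q (day_conv Q F G) G (day_snd G)"
proof -
  interpret quantale Q using Q by (simp add: semicartesian_quantale_def)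
  have le: "w \<sqsubseteq>\<^bsub>Q\<^esub> u \<and> w \<sqsubseteq>\<^bsub>Q\<^esub> v \<and> w \<in> carrier Q \<and> u \<in> carrier Q \<and> v \<in> carrier Q \<and>
      x \<in> sec F u \<and> y \<in> sec G v" if "(u, v, x, y) \<in> day_elts Q F G w" for u v x y w
    using Q that le_trans[of w "u \<odot>\<^bsub>Q\<^esub> v"] unfolding semicartesian_quantale_def day_elts_def by simp
  have mem: "res F u w x \<in> sec F w \<and> res G v w y \<in> sec G w"
    if "(u, v, x, y) \<in> day_elts Q F G w" for u v x y w
    using le[OF that] presheaf_res_closed[OF F, of u w x] presheaf_res_closed[OF G, of v w y]
    by simp
  have nat: "day_fst F w' (day_eq Q F G w' `` C) = res F w w' (day_fst F w C) \<and>
      day_snd G w' (day_eq Q F G w' `` C) = res G w w' (day_snd G w C)"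
    if C: "C \<in> day_elts Q F G w // day_eq Q F G w"
      and w: "w \<in> carrier Q" "w' \<in> carrier Q" "w' \<sqsubseteq>\<^bsub>Q\<^esub> w" for C w w'
  proof -
    obtain u v x y where e: "(u, v, x, y) \<in> day_elts Q F G w" "C = day_eq Q F G w `` {(u, v, x, y)}"
      using C by (auto simp: quotient_def)
    have e': "(u, v, x, y) \<in> day_elts Q F G w'"
      using e(1) day_step_mono(1)[OF quantale_axioms w] by blast
    show ?thesis
      unfolding e(2) day_res_class[OF quantale_axioms w]
        day_fst_class[OF Q F G e(1)] day_fst_class[OF Q F G e']
      using le[OF e(1)] w presheaf_res_comp[OF F, of u w w' x] presheaf_res_comp[OF G, of v w w' y]
      by simp
  qed
  have sec: "day_fst F w C \<in> sec F w \<and> day_snd G w C \<in> sec G w"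
    if "C \<in> day_elts Q F G w // day_eq Q F G w" for C w
    using that mem day_fst_class[OF Q F G] by (auto simp: quotient_def)
  show "nat_trans Q (day_conv Q F G) F (day_fst F)" "nat_trans Q (day_conv Q F G) G (day_snd G)"
    unfolding nat_trans_def using nat sec by (auto simp: day_conv_def)
qed

text \<open>With \<open>e\<close> the unit of \<open>Q\<close>, the maps \<open>day_fst: F \<otimes>\<^bsub>Day\<^esub> Q(-, e) \<rightarrow> F\<close> and
  \<open>day_snd: Q(-, e) \<otimes>\<^bsub>Day\<^esub> G \<rightarrow> G\<close> are isomorphisms, namely the unitors, and in general
  \<open>day_fst\<close> and \<open>day_snd\<close> are the unitors after \<open>F \<otimes> !\<close> and \<open>! \<otimes> G\<close>.\<close>

lemma day_unitors:
  assumes Q: "semicartesian_quantale Q" and F: "is_presheaf Q F"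
    and e: "e \<in> carrier Q" "\<And>a. a \<in> carrier Q \<Longrightarrow> e \<odot>\<^bsub>Q\<^esub> a = a \<and> a \<odot>\<^bsub>Q\<^esub> e = a"
    and w: "w \<in> carrier Q"
  shows "bij_betw (day_fst F w) (sec (day_conv Q F (representable Q arr e)) w) (sec F w)"
    and "bij_betw (day_snd F w) (sec (day_conv Q (representable Q arr e) F) w) (sec F w)"
proof -
  interpret quantale Q using Q by (simp add: semicartesian_quantale_def)
  have dot: "a \<odot>\<^bsub>Q\<^esub> b \<sqsubseteq>\<^bsub>Q\<^esub> a" "a \<odot>\<^bsub>Q\<^esub> b \<sqsubseteq>\<^bsub>Q\<^esub> b" if "a \<in> carrier Q" "b \<in> carrier Q" for a b
    using Q that unfolding semicartesian_quantale_def by auto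
  have top: "a \<sqsubseteq>\<^bsub>Q\<^esub> e" if "a \<in> carrier Q" for a using dot(1)[OF e(1) that] e(2)[OF that] by simp
  have unit: "e \<odot>\<^bsub>Q\<^esub> a = a" "a \<odot>\<^bsub>Q\<^esub> e = a" if "a \<in> carrier Q" for a
    using e(2)[OF that] by simp_all
  let ?Y = "representable Q arr e"
  have Y: "is_presheaf Q ?Y" using representable_is_sheaf[OF Q e(1)] unfolding is_sheaf_def by blast
  have Ysec: "y \<in> sec ?Y v \<longleftrightarrow> y = arr v e" if "v \<in> carrier Q" for y v
    using that top unfolding representable_def by auto
  have Yres: "res ?Y v v' y = arr v' e" for v v' y unfolding representable_def by simp
  have Fid: "res F w w x = x" if "x \<in> sec F w" for x using presheaf_res_id[OF F w that] .
  have Fr: "res F u w x \<in> sec F w" if "x \<in> sec F u" "u \<in> carrier Q" "w \<sqsubseteq>\<^bsub>Q\<^esub> u" for u x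
    using presheaf_res_closed[OF F that(2) w that(3,1)] .

  have c1: "(w, e, x, arr e e) \<in> day_elts Q F ?Y w" if "x \<in> sec F w" for x
    using that w e(1) unit[OF w] le_refl[OF w] Ysec[OF e(1)] unfolding day_elts_def by auto
  have n1: "res F u w x \<in> sec F w \<and>
      ((w, e, res F u w x, arr e e), (u, v, x, y)) \<in> day_eq Q F ?Y w"
    if el: "(u, v, x, y) \<in> day_elts Q F ?Y w" for u v x y
  proof -
    have m: "u \<in> carrier Q" "v \<in> carrier Q" "w \<sqsubseteq>\<^bsub>Q\<^esub> u \<odot>\<^bsub>Q\<^esub> v" "x \<in> sec F u" "y = arr v e"
      using el Ysec unfolding day_elts_def by auto
    have wu: "w \<sqsubseteq>\<^bsub>Q\<^esub> u" using le_trans[OF m(3) dot(1)[OF m(1,2)]] w m by blast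
    have el': "(u, e, x, arr e e) \<in> day_elts Q F ?Y w"
      using m wu w e(1) unit[OF m(1)] Ysec[OF e(1)] unfolding day_elts_def by auto
    have s1: "((u, e, x, arr e e), (u, v, res F u u x, res ?Y e v (arr e e))) \<in> day_step Q F ?Y w"
      by (rule day_stepI[OF el' m(1,2)]) (use m top le_refl in simp_all)
    have s2: "((u, e, x, arr e e), (w, e, res F u w x, res ?Y e e (arr e e))) \<in> day_step Q F ?Y w"
      by (rule day_stepI[OF el' w e(1)]) (use w wu e(1) unit[OF w] le_refl in simp_all)
    have "res F u u x = x" using presheaf_res_id[OF F m(1,4)] .
    then show ?thesis
      using day_eq_common[OF s2 s1] Fr[OF m(4,1) wu] unfolding Yres m(5) by simp
  qed
  show "bij_betw (day_fst F w) (sec (day_conv Q F ?Y) w) (sec F w)"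
  proof (rule bij_betw_byWitness[where f' = "\<lambda>x. day_eq Q F ?Y w `` {(w, e, x, arr e e)}"])
    show "\<forall>C\<in>sec (day_conv Q F ?Y) w. day_eq Q F ?Y w `` {(w, e, day_fst F w C, arr e e)} = C"
    proof
      fix C assume "C \<in> sec (day_conv Q F ?Y) w"
      then obtain u v x y where d: "(u, v, x, y) \<in> day_elts Q F ?Y w" "C = day_eq Q F ?Y w `` {(u, v, x, y)}"
        by (auto simp: day_conv_def quotient_def)
      show "day_eq Q F ?Y w `` {(w, e, day_fst F w C, arr e e)} = C"
        unfolding d(2) day_fst_class(1)[OF Q F Y d(1)]
        by (rule equiv_class_eq[OF day_eq_equiv]) (use n1[OF d(1)] in blast)
    qed
    show "day_fst F w ` sec (day_conv Q F ?Y) w \<subseteq> sec F w"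
      using day_projections_nat_trans(1)[OF Q F Y] w unfolding nat_trans_def by blast
  next
    show "\<forall>x\<in>sec F w. day_fst F w (day_eq Q F ?Y w `` {(w, e, x, arr e e)}) = x"
      using day_fst_class(1)[OF Q F Y c1] Fid by simp
    show "(\<lambda>x. day_eq Q F ?Y w `` {(w, e, x, arr e e)}) ` sec F w \<subseteq> sec (day_conv Q F ?Y) w"
      using c1 by (auto simp: day_conv_def intro: quotientI)
  qed

  have c2: "(e, w, arr e e, x) \<in> day_elts Q ?Y F w" if "x \<in> sec F w" for x
    using that w e(1) unit[OF w] le_refl[OF w] Ysec[OF e(1)] unfolding day_elts_def by auto
  have n2: "res F u w x \<in> sec F w \<and>
      ((e, w, arr e e, res F u w x), (v, u, y, x)) \<in> day_eq Q ?Y F w"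
    if el: "(v, u, y, x) \<in> day_elts Q ?Y F w" for u v x y
  proof -
    have m: "u \<in> carrier Q" "v \<in> carrier Q" "w \<sqsubseteq>\<^bsub>Q\<^esub> v \<odot>\<^bsub>Q\<^esub> u" "x \<in> sec F u" "y = arr v e"
      using el Ysec unfolding day_elts_def by auto
    have wu: "w \<sqsubseteq>\<^bsub>Q\<^esub> u" using le_trans[OF m(3) dot(2)[OF m(2,1)]] w m by blast
    have el': "(e, u, arr e e, x) \<in> day_elts Q ?Y F w"
      using m wu w e(1) unit[OF m(1)] Ysec[OF e(1)] unfolding day_elts_def by auto
    have s1: "((e, u, arr e e, x), (v, u, res ?Y e v (arr e e), res F u u x)) \<in> day_step Q ?Y F w"
      by (rule day_stepI[OF el' m(2,1)]) (use m top le_refl in simp_all)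
    have s2: "((e, u, arr e e, x), (e, w, res ?Y e e (arr e e), res F u w x)) \<in> day_step Q ?Y F w"
      by (rule day_stepI[OF el' e(1) w]) (use w wu e(1) unit[OF w] le_refl in simp_all)
    have "res F u u x = x" using presheaf_res_id[OF F m(1,4)] .
    then show ?thesis
      using day_eq_common[OF s2 s1] Fr[OF m(4,1) wu] unfolding Yres m(5) by simp
  qed
  show "bij_betw (day_snd F w) (sec (day_conv Q ?Y F) w) (sec F w)"
  proof (rule bij_betw_byWitness[where f' = "\<lambda>x. day_eq Q ?Y F w `` {(e, w, arr e e, x)}"])
    show "\<forall>C\<in>sec (day_conv Q ?Y F) w. day_eq Q ?Y F w `` {(e, w, arr e e, day_snd F w C)} = C"
    proof
      fix C assume "C \<in> sec (day_conv Q ?Y F) w"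
      then obtain v u y x where d: "(v, u, y, x) \<in> day_elts Q ?Y F w" "C = day_eq Q ?Y F w `` {(v, u, y, x)}"
        by (auto simp: day_conv_def quotient_def)
      show "day_eq Q ?Y F w `` {(e, w, arr e e, day_snd F w C)} = C"
        unfolding d(2) day_fst_class(2)[OF Q Y F d(1)]
        by (rule equiv_class_eq[OF day_eq_equiv]) (use n2[OF d(1)] in blast)
    qed
    show "day_snd F w ` sec (day_conv Q ?Y F) w \<subseteq> sec F w"
      using day_projections_nat_trans(2)[OF Q Y F] w unfolding nat_trans_def by blast
  next
    show "\<forall>x\<in>sec F w. day_snd F w (day_eq Q ?Y F w `` {(e, w, arr e e, x)}) = x"
      using day_fst_class(2)[OF Q Y F c2] Fid by simp
    show "(\<lambda>x. day_eq Q ?Y F w `` {(e, w, arr e e, x)}) ` sec F w \<subseteq> sec (day_conv Q ?Y F) w"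
      using c2 by (auto simp: day_conv_def intro: quotientI)
  qed
qed

lemma day_projections_via_unit:
  assumes Q: "semicartesian_quantale Q" and F: "is_presheaf Q F" and G: "is_presheaf Q G"
    and e: "e \<in> carrier Q" "\<And>a. a \<in> carrier Q \<Longrightarrow> e \<odot>\<^bsub>Q\<^esub> a = a \<and> a \<odot>\<^bsub>Q\<^esub> e = a"
    and d: "(u, v, x, y) \<in> day_elts Q F G w"
  shows "day_fst F w (day_eq Q F G w `` {(u, v, x, y)}) =
      day_fst F w (day_eq Q F (representable Q arr e) w `` {(u, v, x, arr v e)})"
    and "day_snd G w (day_eq Q F G w `` {(u, v, x, y)}) =
      day_snd G w (day_eq Q (representable Q arr e) G w `` {(u, v, arr u e, y)})"
proof -
  let ?Y = "representable Q arr e"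
  have Y: "is_presheaf Q ?Y" using representable_is_sheaf[OF Q e(1)] unfolding is_sheaf_def by blast
  have "a \<sqsubseteq>\<^bsub>Q\<^esub> e" if "a \<in> carrier Q" for a
  proof -
    have "e \<odot>\<^bsub>Q\<^esub> a \<sqsubseteq>\<^bsub>Q\<^esub> e" using Q e(1) that unfolding semicartesian_quantale_def by blast
    then show ?thesis using e(2)[OF that] by simp
  qed
  then have "(u, v, x, arr v e) \<in> day_elts Q F ?Y w" "(u, v, arr u e, y) \<in> day_elts Q ?Y G w"
    using d unfolding day_elts_def representable_def by auto
  then show "day_fst F w (day_eq Q F G w `` {(u, v, x, y)}) =
      day_fst F w (day_eq Q F ?Y w `` {(u, v, x, arr v e)})"
    and "day_snd G w (day_eq Q F G w `` {(u, v, x, y)}) =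
      day_snd G w (day_eq Q ?Y G w `` {(u, v, arr u e, y)})"
    using day_fst_class[OF Q F G d] day_fst_class(1)[OF Q F Y] day_fst_class(2)[OF Q Y G] by simp_all
qed


section \<open>Sheafification\<close>

text \<open>The sheafification of \<open>P\<close> is the sheaf freely generated by the sections of \<open>P\<close>. Terms are built
  from generators \<open>Gen u x\<close> with \<open>x \<in> P(u)\<close>, formal restrictions \<open>Res v t\<close> to \<open>v\<close>, and formal
  gluings \<open>Glue I f\<close> over \<open>\<Squnion> I\<close> of compatible families \<open>(f i \<in> (aP)(i))\<^bsub>i \<in> I\<^esub>\<close>.
  \<open>sh_eq Q P u t t'\<close> says that \<open>t\<close> and \<open>t'\<close> denote the same section over \<open>u\<close>; it is a partial
  equivalence relation, and \<open>t\<close> denotes a section over \<open>u\<close> iff \<open>sh_eq Q P u t t\<close>. Gluing families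
  indexed by subsets of \<open>Q\<close> suffices, as \<open>separated\<close> identifies the members over a repeated
  index in a compatible family. That this is indeed the left adjoint of the inclusion of
  sheaves into presheaves is \<open>sheafify_is_sheaf\<close>, \<open>sheafify_unit_nat\<close> and
  \<open>sheafify_universal\<close> below.\<close>

datatype ('q, 's) sh_term =
    Gen 'q 's
  | Res 'q "('q, 's) sh_term"
  | Glue "'q set" "'q \<Rightarrow> ('q, 's) sh_term"

inductive sh_eq ::
  "('q, 'm) quantale_struct_scheme \<Rightarrow> ('q, 's) psh \<Rightarrow> 'q \<Rightarrow> ('q, 's) sh_term \<Rightarrow> ('q, 's) sh_term \<Rightarrow> bool"
  for Q :: "('q, 'm) quantale_struct_scheme" and P :: "('q, 's) psh" where
  gen: "\<lbrakk>u \<in> carrier Q; x \<in> sec P u\<rbrakk> \<Longrightarrow> sh_eq Q P u (Gen u x) (Gen u x)"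
| gen_res: "\<lbrakk>u \<in> carrier Q; x \<in> sec P u; v \<in> carrier Q; v \<sqsubseteq>\<^bsub>Q\<^esub> u\<rbrakk> \<Longrightarrow>
    sh_eq Q P v (Res v (Gen u x)) (Gen v (res P u v x))"
| sym: "sh_eq Q P u t t' \<Longrightarrow> sh_eq Q P u t' t"
| trans: "\<lbrakk>sh_eq Q P u t t'; sh_eq Q P u t' t''\<rbrakk> \<Longrightarrow> sh_eq Q P u t t''"
| res_cong: "\<lbrakk>sh_eq Q P u t t'; v \<in> carrier Q; v \<sqsubseteq>\<^bsub>Q\<^esub> u\<rbrakk> \<Longrightarrow> sh_eq Q P v (Res v t) (Res v t')"
| res_id: "sh_eq Q P u t t \<Longrightarrow> sh_eq Q P u (Res u t) t"
| res_comp: "\<lbrakk>sh_eq Q P u t t; v \<in> carrier Q; v \<sqsubseteq>\<^bsub>Q\<^esub> u; w \<in> carrier Q; w \<sqsubseteq>\<^bsub>Q\<^esub> v\<rbrakk> \<Longrightarrow>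
    sh_eq Q P w (Res w (Res v t)) (Res w t)"
| glue_cong: "\<lbrakk>I \<subseteq> carrier Q; \<forall>i\<in>I. sh_eq Q P i (f i) (g i);
    \<forall>i\<in>I. \<forall>j\<in>I. sh_eq Q P (i \<odot>\<^bsub>Q\<^esub> j) (Res (i \<odot>\<^bsub>Q\<^esub> j) (f i)) (Res (i \<odot>\<^bsub>Q\<^esub> j) (f j))\<rbrakk> \<Longrightarrow>
    sh_eq Q P (\<Squnion>\<^bsub>Q\<^esub> I) (Glue I f) (Glue I g)"
| glue_res: "\<lbrakk>I \<subseteq> carrier Q; \<forall>i\<in>I. sh_eq Q P i (f i) (f i);
    \<forall>i\<in>I. \<forall>j\<in>I. sh_eq Q P (i \<odot>\<^bsub>Q\<^esub> j) (Res (i \<odot>\<^bsub>Q\<^esub> j) (f i)) (Res (i \<odot>\<^bsub>Q\<^esub> j) (f j)); k \<in> I\<rbrakk> \<Longrightarrow>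
    sh_eq Q P k (Res k (Glue I f)) (f k)"
| glue_unique: "\<lbrakk>I \<subseteq> carrier Q; sh_eq Q P (\<Squnion>\<^bsub>Q\<^esub> I) t t; sh_eq Q P (\<Squnion>\<^bsub>Q\<^esub> I) t' t';
    \<forall>i\<in>I. sh_eq Q P i (Res i t) (Res i t')\<rbrakk> \<Longrightarrow> sh_eq Q P (\<Squnion>\<^bsub>Q\<^esub> I) t t'"
| separated: "\<lbrakk>sh_eq Q P u t t; sh_eq Q P u t' t';
    sh_eq Q P (u \<odot>\<^bsub>Q\<^esub> u) (Res (u \<odot>\<^bsub>Q\<^esub> u) t) (Res (u \<odot>\<^bsub>Q\<^esub> u) t')\<rbrakk> \<Longrightarrow> sh_eq Q P u t t'"

definition sheafify ::
  "('q, 'm) quantale_struct_scheme \<Rightarrow> ('q, 's) psh \<Rightarrow> ('q, ('q, 's) sh_term set) psh" where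
  "sheafify Q P =
     \<lparr>sec = (\<lambda>u. {t. sh_eq Q P u t t} // {(t, t'). sh_eq Q P u t t'}),
      res = (\<lambda>u v C. \<Union>t\<in>C. {t'. sh_eq Q P v (Res v t) t'})\<rparr>"

definition sheafify_unit ::
  "('q, 'm) quantale_struct_scheme \<Rightarrow> ('q, 's) psh \<Rightarrow> 'q \<Rightarrow> 's \<Rightarrow> ('q, 's) sh_term set" where
  "sheafify_unit Q P u x = {t. sh_eq Q P u (Gen u x) t}"

definition extends_along_unit ::
  "('q, 'm) quantale_struct_scheme \<Rightarrow> ('q, 's) psh \<Rightarrow> ('q, 't) psh \<Rightarrow>
     ('q \<Rightarrow> 's \<Rightarrow> 't) \<Rightarrow> ('q \<Rightarrow> ('q, 's) sh_term set \<Rightarrow> 't) \<Rightarrow> bool" where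
  "extends_along_unit Q P G f g \<longleftrightarrow> nat_trans Q (sheafify Q P) G g \<and>
     nat_eq Q P (\<lambda>u. g u \<circ> sheafify_unit Q P u) f"

lemma sh_eq_carrier: "\<lbrakk>quantale Q; sh_eq Q P u t t'\<rbrakk> \<Longrightarrow> u \<in> carrier Q"
proof -
  assume "quantale Q"
  then interpret quantale Q .
  show "sh_eq Q P u t t' \<Longrightarrow> u \<in> carrier Q"
    by (induction rule: sh_eq.induct) auto
qed

lemma sh_eq_refl: "sh_eq Q P u t t' \<Longrightarrow> sh_eq Q P u t t"
  by (meson sh_eq.sym sh_eq.trans)

lemma sheafify_sec:
  "C \<in> sec (sheafify Q P) u \<longleftrightarrow> (\<exists>t. sh_eq Q P u t t \<and> C = {t'. sh_eq Q P u t t'})"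
  by (auto simp: sheafify_def quotient_def)

lemma sheafify_secE:
  assumes "C \<in> sec (sheafify Q P) u"
  obtains t where "sh_eq Q P u t t" "C = {t'. sh_eq Q P u t t'}"
  using assms unfolding sheafify_sec by blast

lemma sheafify_secI: "sh_eq Q P u t t \<Longrightarrow> {t'. sh_eq Q P u t t'} \<in> sec (sheafify Q P) u"
  unfolding sheafify_sec by blast

lemma sheafify_class_cong:
  "sh_eq Q P u t t' \<Longrightarrow> {s. sh_eq Q P u t s} = {s. sh_eq Q P u t' s}"
  by (auto intro: sh_eq.sym sh_eq.trans)

lemma sheafify_class_eq:
  "sh_eq Q P u t t \<Longrightarrow> {s. sh_eq Q P u t s} = {s. sh_eq Q P u t' s} \<longleftrightarrow> sh_eq Q P u t t'"
  by (auto intro: sh_eq.sym sh_eq.trans)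

lemma sheafify_res:
  assumes "sh_eq Q P u t t" "v \<in> carrier Q" "v \<sqsubseteq>\<^bsub>Q\<^esub> u"
  shows "res (sheafify Q P) u v {s. sh_eq Q P u t s} = {s. sh_eq Q P v (Res v t) s}"
  using assms by (auto simp: sheafify_def intro: sh_eq.trans sh_eq.res_cong)

lemma sheafify_is_presheaf:
  assumes "quantale Q"
  shows "is_presheaf Q (sheafify Q P)"
proof -
  interpret quantale Q by fact
  have 1: "res (sheafify Q P) u v C \<in> sec (sheafify Q P) v"
    if C: "C \<in> sec (sheafify Q P) u" and v: "v \<in> carrier Q" "v \<sqsubseteq>\<^bsub>Q\<^esub> u" for u v C
  proof -
    obtain t where t: "sh_eq Q P u t t" "C = {s. sh_eq Q P u t s}" using C by (rule sheafify_secE)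
    show ?thesis unfolding t(2) sheafify_res[OF t(1) v]
      using sheafify_secI[OF sh_eq.res_cong[OF t(1) v]] .
  qed
  have 2: "res (sheafify Q P) u u C = C" if C: "C \<in> sec (sheafify Q P) u" and u: "u \<in> carrier Q" for u C
  proof -
    obtain t where t: "sh_eq Q P u t t" "C = {s. sh_eq Q P u t s}" using C by (rule sheafify_secE)
    show ?thesis
      unfolding t(2) sheafify_res[OF t(1) u le_refl[OF u]]
      using sheafify_class_cong[OF sh_eq.res_id[OF t(1)]] .
  qed
  have 3: "res (sheafify Q P) v w (res (sheafify Q P) u v C) = res (sheafify Q P) u w C"
    if C: "C \<in> sec (sheafify Q P) u" and u: "u \<in> carrier Q"
      and v: "v \<in> carrier Q" "v \<sqsubseteq>\<^bsub>Q\<^esub> u" and w: "w \<in> carrier Q" "w \<sqsubseteq>\<^bsub>Q\<^esub> v" for u v w C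
  proof -
    obtain t where t: "sh_eq Q P u t t" "C = {s. sh_eq Q P u t s}" using C by (rule sheafify_secE)
    have wu: "w \<sqsubseteq>\<^bsub>Q\<^esub> u" using le_trans[OF w(2) v(2) w(1) v(1) u] .
    show ?thesis
      unfolding t(2) sheafify_res[OF t(1) v] sheafify_res[OF t(1) w(1) wu]
        sheafify_res[OF sh_eq.res_cong[OF t(1) v] w]
      using sheafify_class_cong[OF sh_eq.res_comp[OF t(1) v w]] .
  qed
  show ?thesis unfolding is_presheaf_def
    by (intro conjI ballI impI Pi_I) (use 1 2 3 in \<open>simp_all\<close>)
qed

lemma sheafify_is_sheaf:
  assumes Q: "semicartesian_quantale Q"
  shows "is_sheaf Q (sheafify Q P)"
proof -
  interpret quantale Q using Q by (simp add: semicartesian_quantale_def)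
  have dot: "a \<odot>\<^bsub>Q\<^esub> b \<sqsubseteq>\<^bsub>Q\<^esub> a" "a \<odot>\<^bsub>Q\<^esub> b \<sqsubseteq>\<^bsub>Q\<^esub> b" if "a \<in> carrier Q" "b \<in> carrier Q" for a b
    using Q that unfolding semicartesian_quantale_def by auto
  show ?thesis unfolding is_sheaf_def
  proof (intro conjI allI impI sheafify_is_presheaf quantale_axioms)
    fix I :: "('a \<times> ('a, 'c) sh_term set) set" and U s
    assume c: "compatible Q (sheafify Q P) I U s"
    let ?u = "\<Squnion>\<^bsub>Q\<^esub> (U ` I)"
    have U: "U ` I \<subseteq> carrier Q" using c unfolding compatible_def by auto
    have Uc: "U i \<in> carrier Q" if "i \<in> I" for i using U that by blast
    have "\<forall>i\<in>I. \<exists>t. sh_eq Q P (U i) t t \<and> s i = {t'. sh_eq Q P (U i) t t'}"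
      using c unfolding compatible_def sheafify_sec by blast
    then obtain r where r: "\<And>i. i \<in> I \<Longrightarrow> sh_eq Q P (U i) (r i) (r i)"
      and s: "\<And>i. i \<in> I \<Longrightarrow> s i = {t'. sh_eq Q P (U i) (r i) t'}" by metis
    have comp: "sh_eq Q P (U i \<odot>\<^bsub>Q\<^esub> U j) (Res (U i \<odot>\<^bsub>Q\<^esub> U j) (r i)) (Res (U i \<odot>\<^bsub>Q\<^esub> U j) (r j))"
      if i: "i \<in> I" and j: "j \<in> I" for i j
    proof -
      let ?w = "U i \<odot>\<^bsub>Q\<^esub> U j"
      have w: "?w \<in> carrier Q" "?w \<sqsubseteq>\<^bsub>Q\<^esub> U i" "?w \<sqsubseteq>\<^bsub>Q\<^esub> U j"
        using dot[of "U i" "U j"] Uc[OF i] Uc[OF j] by simp_all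
      have "res (sheafify Q P) (U i) ?w (s i) = res (sheafify Q P) (U j) ?w (s j)"
        using c i j unfolding compatible_def by blast
      then have "{t. sh_eq Q P ?w (Res ?w (r i)) t} = {t. sh_eq Q P ?w (Res ?w (r j)) t}"
        unfolding s[OF i] s[OF j] sheafify_res[OF r[OF i] w(1,2)] sheafify_res[OF r[OF j] w(1,3)] .
      then show ?thesis
        using sheafify_class_eq[OF sh_eq.res_cong[OF r[OF i] w(1,2)]] by blast
    qed
    define k where "k q = (SOME i. i \<in> I \<and> U i = q)" for q
    have k: "k (U i) \<in> I" "U (k (U i)) = U i" if "i \<in> I" for i
      using someI[of "\<lambda>j. j \<in> I \<and> U j = U i" i] that unfolding k_def by auto
    define f where "f q = r (k q)" for q
    have rf: "sh_eq Q P (U i) (f (U i)) (r i)" if i: "i \<in> I" for i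
    proof -
      have "sh_eq Q P (U i) (r (k (U i))) (r (k (U i)))" using r[OF k(1)[OF i]] k(2)[OF i] by simp
      moreover have "sh_eq Q P (U i \<odot>\<^bsub>Q\<^esub> U i) (Res (U i \<odot>\<^bsub>Q\<^esub> U i) (r (k (U i)))) (Res (U i \<odot>\<^bsub>Q\<^esub> U i) (r i))"
        using comp[OF k(1)[OF i] i] k(2)[OF i] by simp
      ultimately show ?thesis unfolding f_def by (rule sh_eq.separated[OF _ r[OF i]])
    qed
    have f1: "\<forall>q\<in>U ` I. sh_eq Q P q (f q) (f q)"
      using sh_eq_refl[OF rf] by blast
    have f2: "\<forall>p\<in>U ` I. \<forall>q\<in>U ` I. sh_eq Q P (p \<odot>\<^bsub>Q\<^esub> q) (Res (p \<odot>\<^bsub>Q\<^esub> q) (f p)) (Res (p \<odot>\<^bsub>Q\<^esub> q) (f q))"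
    proof (clarify)
      fix i j assume "i \<in> I" "j \<in> I"
      then show "sh_eq Q P (U i \<odot>\<^bsub>Q\<^esub> U j) (Res (U i \<odot>\<^bsub>Q\<^esub> U j) (f (U i))) (Res (U i \<odot>\<^bsub>Q\<^esub> U j) (f (U j)))"
        unfolding f_def using comp[OF k(1) k(1)] k(2) by metis
    qed
    let ?g = "Glue (U ` I) f"
    have g: "sh_eq Q P ?u ?g ?g" using sh_eq.glue_cong[OF U f1 f2] .
    have gr: "sh_eq Q P (U i) (Res (U i) ?g) (r i)" if "i \<in> I" for i
      using sh_eq.trans[OF sh_eq.glue_res[OF U f1 f2 imageI[OF that]] rf[OF that]] .
    have up: "U i \<in> carrier Q" "U i \<sqsubseteq>\<^bsub>Q\<^esub> ?u" if "i \<in> I" for i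
      using U sup_upper[OF U imageI[OF that]] that by blast+
    show "\<exists>!z. glues Q (sheafify Q P) I U s z"
    proof (rule ex1I)
      have "res (sheafify Q P) ?u (U i) {t. sh_eq Q P ?u ?g t} = s i" if i: "i \<in> I" for i
        unfolding s[OF i] sheafify_res[OF g up[OF i]]
        using sheafify_class_cong[OF gr[OF i]] .
      then show "glues Q (sheafify Q P) I U s {t. sh_eq Q P ?u ?g t}"
        unfolding glues_def sheafify_sec using g by blast
    next
      fix z assume z: "glues Q (sheafify Q P) I U s z"
      then obtain t where t: "sh_eq Q P ?u t t" "z = {t'. sh_eq Q P ?u t t'}"
        unfolding glues_def sheafify_sec by blast
      have "sh_eq Q P (U i) (Res (U i) t) (Res (U i) ?g)" if i: "i \<in> I" for i
      proof -
        have "res (sheafify Q P) ?u (U i) z = s i" using z i unfolding glues_def by blast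
        then have "{t'. sh_eq Q P (U i) (Res (U i) t) t'} = {t'. sh_eq Q P (U i) (r i) t'}"
          unfolding t(2) sheafify_res[OF t(1) up[OF i]] s[OF i] .
        then have "sh_eq Q P (U i) (Res (U i) t) (r i)"
          using sheafify_class_eq[OF sh_eq.res_cong[OF t(1) up[OF i]]] by blast
        then show ?thesis using sh_eq.sym[OF gr[OF i]] by (rule sh_eq.trans)
      qed
      then have "sh_eq Q P ?u t ?g" by (intro sh_eq.glue_unique[OF U t(1) g]) blast
      then show "z = {t. sh_eq Q P ?u ?g t}"
        unfolding t(2) by (rule sheafify_class_cong)
    qed
  qed
qed

lemma sheafify_unit_nat:
  assumes "quantale Q" "is_presheaf Q P"
  shows "nat_trans Q P (sheafify Q P) (sheafify_unit Q P)"
  unfolding nat_trans_def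
proof (intro conjI ballI impI)
  fix u assume u: "u \<in> carrier Q"
  show "sheafify_unit Q P u \<in> sec P u \<rightarrow> sec (sheafify Q P) u"
    unfolding sheafify_unit_def by (intro Pi_I sheafify_secI sh_eq.gen[OF u])
  fix v x assume v: "v \<in> carrier Q" "v \<sqsubseteq>\<^bsub>Q\<^esub> u" and x: "x \<in> sec P u"
  show "sheafify_unit Q P v (res P u v x) = res (sheafify Q P) u v (sheafify_unit Q P u x)"
    unfolding sheafify_unit_def sheafify_res[OF sh_eq.gen[OF u x] v]
    using sheafify_class_cong[OF sh_eq.gen_res[OF u x v]] by simp
qed

primrec sh_level :: "('q, 'm) quantale_struct_scheme \<Rightarrow> ('q, 's) sh_term \<Rightarrow> 'q" where
  "sh_level Q (Gen u x) = u"
| "sh_level Q (Res v t) = v"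
| "sh_level Q (Glue I f) = \<Squnion>\<^bsub>Q\<^esub> I"

primrec sh_eval :: "('q, 'm) quantale_struct_scheme \<Rightarrow> ('q, 't) psh \<Rightarrow> ('q \<Rightarrow> 's \<Rightarrow> 't) \<Rightarrow>
    ('q, 's) sh_term \<Rightarrow> 't" where
  "sh_eval Q G h (Gen u x) = h u x"
| "sh_eval Q G h (Res v t) = res G (sh_level Q t) v (sh_eval Q G h t)"
| "sh_eval Q G h (Glue I f) = (THE z. glues Q G I (\<lambda>i. i) (\<lambda>i. sh_eval Q G h (f i)) z)"

lemma sh_eq_level:
  "sh_eq Q P u t t' \<Longrightarrow> sh_level Q t = u \<and> sh_level Q t' = u"
  by (induction rule: sh_eq.induct) auto

lemma sheaf_separated:
  assumes "is_sheaf Q G" "I \<subseteq> carrier Q" "z \<in> sec G (\<Squnion>\<^bsub>Q\<^esub> I)" "z' \<in> sec G (\<Squnion>\<^bsub>Q\<^esub> I)"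
    and "\<And>i. i \<in> I \<Longrightarrow> res G (\<Squnion>\<^bsub>Q\<^esub> I) i z = res G (\<Squnion>\<^bsub>Q\<^esub> I) i z'"
    and "semicartesian_quantale Q"
  shows "z = z'"
proof -
  interpret quantale Q using assms(6) by (simp add: semicartesian_quantale_def)
  have dot: "a \<odot>\<^bsub>Q\<^esub> b \<sqsubseteq>\<^bsub>Q\<^esub> a" "a \<odot>\<^bsub>Q\<^esub> b \<sqsubseteq>\<^bsub>Q\<^esub> b" if "a \<in> carrier Q" "b \<in> carrier Q" for a b
    using assms(6) that unfolding semicartesian_quantale_def by auto
  have G: "is_presheaf Q G" using assms(1) unfolding is_sheaf_def by blast
  have up: "i \<sqsubseteq>\<^bsub>Q\<^esub> \<Squnion>\<^bsub>Q\<^esub> I" "i \<in> carrier Q" if "i \<in> I" for i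
    using assms(2) sup_upper[OF assms(2) that] that by blast+
  let ?u = "\<Squnion>\<^bsub>Q\<^esub> I"
  have u: "?u \<in> carrier Q" using assms(2) by simp
  have rr: "res G i w (res G ?u i z) = res G ?u w z"
    if "i \<in> I" "w \<in> carrier Q" "w \<sqsubseteq>\<^bsub>Q\<^esub> i" for i w
    using presheaf_res_comp[OF G u up(2)[OF that(1)] that(2) up(1)[OF that(1)] that(3) assms(3)] .
  have "compatible Q G I (\<lambda>i. i) (\<lambda>i. res G ?u i z)"
    unfolding compatible_def
  proof (intro conjI ballI)
    fix i assume i: "i \<in> I"
    show "i \<in> carrier Q" using up i by blast
    show "res G ?u i z \<in> sec G i" using presheaf_res_closed[OF G u up(2,1)[OF i] assms(3)] .
    fix j assume j: "j \<in> I"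
    show "res G i (i \<odot>\<^bsub>Q\<^esub> j) (res G ?u i z) = res G j (i \<odot>\<^bsub>Q\<^esub> j) (res G ?u j z)"
      using up[OF i] up[OF j] dot by (simp add: rr i j)
  qed
  then have "\<exists>!x. glues Q G I (\<lambda>i. i) (\<lambda>i. res G ?u i z) x"
    using sheaf_any_index[OF assms(1)] by blast
  moreover have "glues Q G I (\<lambda>i. i) (\<lambda>i. res G ?u i z) z"
    unfolding glues_def using assms(3) by simp
  moreover have "glues Q G I (\<lambda>i. i) (\<lambda>i. res G ?u i z) z'"
    unfolding glues_def using assms(4,5) by simp
  ultimately show ?thesis by blast
qed

lemma sh_eval_sound:
  assumes Q: "semicartesian_quantale Q" and G: "is_sheaf Q G" and h: "nat_trans Q P G h"
  shows "sh_eq Q P u t t' \<Longrightarrow> sh_eval Q G h t = sh_eval Q G h t' \<and> sh_eval Q G h t \<in> sec G u"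
proof -
  interpret quantale Q using Q by (simp add: semicartesian_quantale_def)
  have dot: "a \<odot>\<^bsub>Q\<^esub> b \<sqsubseteq>\<^bsub>Q\<^esub> a" "a \<odot>\<^bsub>Q\<^esub> b \<sqsubseteq>\<^bsub>Q\<^esub> b" if "a \<in> carrier Q" "b \<in> carrier Q" for a b
    using Q that unfolding semicartesian_quantale_def by auto
  have Gp: "is_presheaf Q G" using G unfolding is_sheaf_def by blast
  have Gr: "res G u v x \<in> sec G v" if "u \<in> carrier Q" "v \<in> carrier Q" "v \<sqsubseteq>\<^bsub>Q\<^esub> u" "x \<in> sec G u" for u v x
    using presheaf_res_closed[OF Gp that] .
  have gl: "glues Q G I (\<lambda>i. i) (\<lambda>i. sh_eval Q G h (f i)) (sh_eval Q G h (Glue I f))"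
    if I: "I \<subseteq> carrier Q" and l: "\<And>i. i \<in> I \<Longrightarrow> sh_level Q (f i) = i"
      and f: "\<And>i. i \<in> I \<Longrightarrow> sh_eval Q G h (f i) \<in> sec G i"
      and c: "\<And>i j. \<lbrakk>i \<in> I; j \<in> I\<rbrakk> \<Longrightarrow> sh_eval Q G h (Res (i \<odot>\<^bsub>Q\<^esub> j) (f i)) = sh_eval Q G h (Res (i \<odot>\<^bsub>Q\<^esub> j) (f j))"
    for I f
  proof -
    have "compatible Q G I (\<lambda>i. i) (\<lambda>i. sh_eval Q G h (f i))"
      unfolding compatible_def using I f c l by auto
    from theI'[OF sheaf_any_index[OF G this]] show ?thesis by simp
  qed
  show "sh_eq Q P u t t' \<Longrightarrow> sh_eval Q G h t = sh_eval Q G h t' \<and> sh_eval Q G h t \<in> sec G u"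
  proof (induction rule: sh_eq.induct)
    case (gen u x)
    then show ?case using h unfolding nat_trans_def by auto
  next
    case (gen_res u x v)
    then show ?case using h Gr[of u v "h u x"] unfolding nat_trans_def by (auto simp: Pi_iff)
  next
    case (sym u t t')
    then show ?case by metis
  next
    case (trans u t t' t'')
    then show ?case by metis
  next
    case (res_cong u t t' v)
    have t: "sh_eval Q G h t = sh_eval Q G h t'" "sh_eval Q G h t \<in> sec G u"
      using res_cong by blast+
    show ?case
      using sh_eq_level[OF res_cong(1)] t(1)
        Gr[OF sh_eq_carrier[OF quantale_axioms res_cong(1)] res_cong(2,3) t(2)] by simp
  next
    case (res_id u t)
    then show ?case
      using sh_eq_level[OF res_id(1)] sh_eq_carrier[OF quantale_axioms res_id(1)] res_id
        presheaf_res_id[OF Gp, of u]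
      by simp
  next
    case (res_comp u t v w)
    have u: "u \<in> carrier Q" using sh_eq_carrier[OF quantale_axioms res_comp(1)] .
    have w: "w \<sqsubseteq>\<^bsub>Q\<^esub> u" using le_trans[OF res_comp(5,3,4,2) u] .
    have t: "sh_eval Q G h t \<in> sec G u" using res_comp by blast
    show ?case
      using sh_eq_level[OF res_comp(1)] Gr[OF u res_comp(4) w t]
        presheaf_res_comp[OF Gp u res_comp(2,4,3,5) t] by simp
  next
    case (glue_cong I f g)
    have "glues Q G I (\<lambda>i. i) (\<lambda>i. sh_eval Q G h (f i)) (sh_eval Q G h (Glue I f))"
    proof (rule gl[OF glue_cong(1)])
      fix i assume i: "i \<in> I"
      have E: "sh_eq Q P i (f i) (g i)" "sh_eval Q G h (f i) \<in> sec G i" using glue_cong(2) i by blast+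
      show "sh_level Q (f i) = i" using sh_eq_level[OF E(1)] by blast
      show "sh_eval Q G h (f i) \<in> sec G i" using E(2) .
    next
      fix i j assume "i \<in> I" "j \<in> I"
      then show "sh_eval Q G h (Res (i \<odot>\<^bsub>Q\<^esub> j) (f i)) = sh_eval Q G h (Res (i \<odot>\<^bsub>Q\<^esub> j) (f j))"
        using glue_cong(3) by blast
    qed
    moreover have "glues Q G I (\<lambda>i. i) (\<lambda>i. sh_eval Q G h (f i)) z \<longleftrightarrow>
        glues Q G I (\<lambda>i. i) (\<lambda>i. sh_eval Q G h (g i)) z" for z
      unfolding glues_def using glue_cong(2) by (metis (no_types, lifting))
    then have "sh_eval Q G h (Glue I f) = sh_eval Q G h (Glue I g)" by simp
    ultimately show ?case unfolding glues_def by simp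
  next
    case (glue_res I f k)
    have "glues Q G I (\<lambda>i. i) (\<lambda>i. sh_eval Q G h (f i)) (sh_eval Q G h (Glue I f))"
    proof (rule gl[OF glue_res(1)])
      fix i assume i: "i \<in> I"
      have E: "sh_eq Q P i (f i) (f i)" "sh_eval Q G h (f i) \<in> sec G i" using glue_res(3) i by blast+
      show "sh_level Q (f i) = i" using sh_eq_level[OF E(1)] by blast
      show "sh_eval Q G h (f i) \<in> sec G i" using E(2) .
    next
      fix i j assume "i \<in> I" "j \<in> I"
      then show "sh_eval Q G h (Res (i \<odot>\<^bsub>Q\<^esub> j) (f i)) = sh_eval Q G h (Res (i \<odot>\<^bsub>Q\<^esub> j) (f j))"
        using glue_res(4) by blast
    qed
    then have "res G (\<Squnion>\<^bsub>Q\<^esub> I) k (sh_eval Q G h (Glue I f)) = sh_eval Q G h (f k)"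
      using glue_res(2) unfolding glues_def by simp
    moreover have "sh_eval Q G h (f k) \<in> sec G k" using glue_res(3,2) by blast
    ultimately show ?case by simp
  next
    case (glue_unique I t t')
    have l: "sh_level Q t = \<Squnion>\<^bsub>Q\<^esub> I" "sh_level Q t' = \<Squnion>\<^bsub>Q\<^esub> I"
      using sh_eq_level[OF glue_unique(2)] sh_eq_level[OF glue_unique(3)] by simp_all
    have "sh_eval Q G h t = sh_eval Q G h t'"
    proof (rule sheaf_separated[OF G glue_unique(1) _ _ _ Q])
      show "sh_eval Q G h t \<in> sec G (\<Squnion>\<^bsub>Q\<^esub> I)" "sh_eval Q G h t' \<in> sec G (\<Squnion>\<^bsub>Q\<^esub> I)"
        using glue_unique(4,5) by simp_all
      fix i assume "i \<in> I"
      then have "sh_eval Q G h (Res i t) = sh_eval Q G h (Res i t')" using glue_unique(6) by blast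
      then show "res G (\<Squnion>\<^bsub>Q\<^esub> I) i (sh_eval Q G h t) = res G (\<Squnion>\<^bsub>Q\<^esub> I) i (sh_eval Q G h t')"
        by (simp add: l)
    qed
    then show ?case using glue_unique(4) by simp
  next
    case (separated u t t')
    let ?s = "\<lambda>b. if b then sh_eval Q G h t else sh_eval Q G h t'"
    have u: "u \<in> carrier Q" using sh_eq_carrier[OF quantale_axioms separated(1)] .
    have l: "sh_level Q t = u" "sh_level Q t' = u"
      using sh_eq_level[OF separated(1)] sh_eq_level[OF separated(2)] by simp_all
    have "compatible Q G (UNIV :: bool set) (\<lambda>_. u) ?s"
      unfolding compatible_def using separated.IH u by (simp add: l)
    then obtain z where "glues Q G (UNIV :: bool set) (\<lambda>_. u) ?s z"
      using sheaf_any_index[OF G] by blast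
    then have "\<forall>b. res G u u z = ?s b" unfolding glues_def using u by auto
    from this[rule_format, of True] this[rule_format, of False]
    show ?case using separated.IH by simp
  qed
qed

lemma extends_along_unit_exists:
  assumes Q: "semicartesian_quantale Q" and P: "is_presheaf Q P" and G: "is_sheaf Q G"
    and h: "nat_trans Q P G h"
  shows "\<exists>g. extends_along_unit Q P G h g"
proof
  interpret quantale Q using Q by (simp add: semicartesian_quantale_def)
  note sound = sh_eval_sound[OF Q G h]
  define g where "g u C = sh_eval Q G h (SOME t. t \<in> C)" for u :: 'a and C
  have g: "g u {s. sh_eq Q P u t s} = sh_eval Q G h t" if t: "sh_eq Q P u t t" for u t
  proof -
    have "(SOME s. s \<in> {s. sh_eq Q P u t s}) \<in> {s. sh_eq Q P u t s}"
      by (rule someI[of _ t]) (simp add: t)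
    then show ?thesis unfolding g_def using sound by fastforce
  qed
  have "nat_trans Q (sheafify Q P) G g" unfolding nat_trans_def
  proof (intro conjI ballI impI)
    fix u assume "u \<in> carrier Q"
    show "g u \<in> sec (sheafify Q P) u \<rightarrow> sec G u"
    proof
      fix C assume "C \<in> sec (sheafify Q P) u"
      then obtain t where t: "sh_eq Q P u t t" "C = {s. sh_eq Q P u t s}" by (rule sheafify_secE)
      show "g u C \<in> sec G u" unfolding t(2) g[OF t(1)] using sound[OF t(1)] by blast
    qed
    fix v C assume v: "v \<in> carrier Q" "v \<sqsubseteq>\<^bsub>Q\<^esub> u" and "C \<in> sec (sheafify Q P) u"
    from this(3) obtain t where t: "sh_eq Q P u t t" "C = {s. sh_eq Q P u t s}"
      by (rule sheafify_secE)
    show "g v (res (sheafify Q P) u v C) = res G u v (g u C)"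
      unfolding t(2) sheafify_res[OF t(1) v] g[OF t(1)] g[OF sh_eq.res_cong[OF t(1) v]]
      using sh_eq_level[OF t(1)] by simp
  qed
  moreover have "nat_eq Q P (\<lambda>u. g u \<circ> sheafify_unit Q P u) h"
    unfolding nat_eq_def sheafify_unit_def using g[OF sh_eq.gen] by simp
  ultimately show "extends_along_unit Q P G h g" unfolding extends_along_unit_def by blast
qed

lemma extends_along_unit_unique:
  assumes Q: "semicartesian_quantale Q" and G: "is_sheaf Q G"
    and g: "extends_along_unit Q P G h g" and g': "extends_along_unit Q P G h g'"
  shows "nat_eq Q (sheafify Q P) g g'"
proof -
  interpret quantale Q using Q by (simp add: semicartesian_quantale_def)
  define cl where "cl u t = {s. sh_eq Q P u t s}" for u t
  have cl_sec: "cl u t \<in> sec (sheafify Q P) u" if "sh_eq Q P u t t" for u t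
    using sheafify_secI[OF that] unfolding cl_def .
  have cl_eq: "cl u t = cl u t'" if "sh_eq Q P u t t'" for u t t'
    using sheafify_class_cong[OF that] unfolding cl_def .
  have cl_res: "k v (cl v (Res v t)) = res G u v (k u (cl u t))"
    if k: "extends_along_unit Q P G h k" and t: "sh_eq Q P u t t"
      and v: "v \<in> carrier Q" "v \<sqsubseteq>\<^bsub>Q\<^esub> u" for u t v k
  proof -
    have "k v (res (sheafify Q P) u v (cl u t)) = res G u v (k u (cl u t))"
      using k cl_sec[OF t] v sh_eq_carrier[OF quantale_axioms t]
      unfolding extends_along_unit_def nat_trans_def by blast
    then show ?thesis using sheafify_res[OF t v] unfolding cl_def by simp
  qed
  have cl_gen: "k u (cl u (Gen u x)) = h u x"
    if "extends_along_unit Q P G h k" "u \<in> carrier Q" "x \<in> sec P u" for k u x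
    using that unfolding extends_along_unit_def nat_eq_def sheafify_unit_def cl_def by auto
  have cl_mem: "k u (cl u t) \<in> sec G u" if "extends_along_unit Q P G h k" "sh_eq Q P u t t" for k u t
    using that cl_sec[OF that(2)] sh_eq_carrier[OF quantale_axioms that(2)]
    unfolding extends_along_unit_def nat_trans_def by blast
  have main: "g u (cl u t) = g' u (cl u t)" if "sh_eq Q P u t t'" for u t t'
    using that
  proof (induction rule: sh_eq.induct)
    case (gen u x)
    then show ?case by (simp only: cl_gen[OF g] cl_gen[OF g'])
  next
    case (gen_res u x v)
    then show ?case
      using cl_res[OF g sh_eq.gen[OF gen_res(1,2)] gen_res(3,4)]
        cl_res[OF g' sh_eq.gen[OF gen_res(1,2)] gen_res(3,4)]
      by (simp only: cl_gen[OF g] cl_gen[OF g'])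
  next
    case (sym u t t')
    then show ?case using cl_eq[OF sym(1)] by simp
  next
    case (trans u t t' t'')
    then show ?case by simp
  next
    case (res_cong u t t' v)
    then show ?case
      using cl_res[OF g sh_eq_refl[OF res_cong(1)] res_cong(2,3)]
        cl_res[OF g' sh_eq_refl[OF res_cong(1)] res_cong(2,3)] by simp
  next
    case (res_id u t)
    show ?case unfolding cl_eq[OF sh_eq.res_id[OF res_id(1)]] using res_id(2) .
  next
    case (res_comp u t v w)
    note tv = sh_eq.res_cong[OF res_comp(1-3)]
    show ?case
      using cl_res[OF g tv res_comp(4,5)] cl_res[OF g' tv res_comp(4,5)]
        cl_res[OF g res_comp(1-3)] cl_res[OF g' res_comp(1-3)] res_comp(6) by simp
  next
    case (glue_cong I f k)
    have ff: "\<forall>i\<in>I. sh_eq Q P i (f i) (f i)"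
    proof
      fix i assume "i \<in> I"
      then have "sh_eq Q P i (f i) (k i)" using glue_cong(2) by blast
      then show "sh_eq Q P i (f i) (f i)" by (rule sh_eq_refl)
    qed
    have c: "\<forall>i\<in>I. \<forall>j\<in>I. sh_eq Q P (i \<odot>\<^bsub>Q\<^esub> j) (Res (i \<odot>\<^bsub>Q\<^esub> j) (f i)) (Res (i \<odot>\<^bsub>Q\<^esub> j) (f j))"
      using glue_cong(3) by blast
    have gg: "sh_eq Q P (\<Squnion>\<^bsub>Q\<^esub> I) (Glue I f) (Glue I f)"
      using sh_eq.glue_cong[OF glue_cong(1) ff c] .
    have up: "i \<sqsubseteq>\<^bsub>Q\<^esub> \<Squnion>\<^bsub>Q\<^esub> I" "i \<in> carrier Q" if "i \<in> I" for i
      using glue_cong(1) sup_upper[OF glue_cong(1) that] that by blast+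
    show ?case
    proof (rule sheaf_separated[OF G glue_cong(1) cl_mem[OF g gg] cl_mem[OF g' gg] _ Q])
      fix i assume i: "i \<in> I"
      have "cl i (Res i (Glue I f)) = cl i (f i)"
        by (rule cl_eq[OF sh_eq.glue_res[OF glue_cong(1) ff c i]])
      moreover have "g i (cl i (f i)) = g' i (cl i (f i))" using glue_cong(2) i by blast
      ultimately show "res G (\<Squnion>\<^bsub>Q\<^esub> I) i (g (\<Squnion>\<^bsub>Q\<^esub> I) (cl (\<Squnion>\<^bsub>Q\<^esub> I) (Glue I f))) =
          res G (\<Squnion>\<^bsub>Q\<^esub> I) i (g' (\<Squnion>\<^bsub>Q\<^esub> I) (cl (\<Squnion>\<^bsub>Q\<^esub> I) (Glue I f)))"
        using cl_res[OF g gg up(2,1)[OF i]] cl_res[OF g' gg up(2,1)[OF i]] by simp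
    qed
  next
    case (glue_res I f k)
    have "sh_eq Q P k (Res k (Glue I f)) (f k)"
      by (rule sh_eq.glue_res[OF glue_res(1) _ _ glue_res(2)]) (use glue_res(3,4) in blast)+
    then have "cl k (Res k (Glue I f)) = cl k (f k)" by (rule cl_eq)
    moreover have "g k (cl k (f k)) = g' k (cl k (f k))" using glue_res(2,3) by blast
    ultimately show ?case by simp
  next
    case (glue_unique I t t')
    then show ?case by simp
  next
    case (separated u t t')
    then show ?case by simp
  qed
  show ?thesis
    unfolding nat_eq_def
  proof (intro ballI)
    fix u C assume "C \<in> sec (sheafify Q P) u"
    then obtain t where t: "sh_eq Q P u t t" "C = {s. sh_eq Q P u t s}" by (rule sheafify_secE)
    show "g u C = g' u C" using main[OF t(1)] unfolding t(2) cl_def .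
  qed
qed

text \<open>The universal property of the unit \<open>P \<rightarrow> aP\<close>, for sheaves \<open>G\<close> with values in any type.\<close>

theorem sheafify_universal:
  assumes "semicartesian_quantale Q" "is_presheaf Q P" "is_sheaf Q G" "nat_trans Q P G f"
  shows "\<exists>g. extends_along_unit Q P G f g \<and>
    (\<forall>g'. extends_along_unit Q P G f g' \<longrightarrow> nat_eq Q (sheafify Q P) g g')"
  using extends_along_unit_exists[OF assms] extends_along_unit_unique[OF assms(1,3)] by blast


text \<open>The transpose \<open>aP \<rightarrow> G\<close> of \<open>f: P \<rightarrow> G\<close>; unique as far as its values on sections are
  concerned.\<close>

definition sheafify_ext ::
  "('q, 'm) quantale_struct_scheme \<Rightarrow> ('q, 's) psh \<Rightarrow> ('q, 't) psh \<Rightarrow>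
     ('q \<Rightarrow> 's \<Rightarrow> 't) \<Rightarrow> ('q \<Rightarrow> ('q, 's) sh_term set \<Rightarrow> 't)" where
  "sheafify_ext Q P G f = (SOME g. extends_along_unit Q P G f g)"


section \<open>Tensor product of sheaves and the operation on subobjects\<close>

definition sheaf_tensor ::
  "('q, 'm) quantale_struct_scheme \<Rightarrow> ('q, 's) psh \<Rightarrow> ('q, 't) psh \<Rightarrow>
     ('q, ('q, ('q \<times> 'q \<times> 's \<times> 't) set) sh_term set) psh" where
  "sheaf_tensor Q F G = sheafify Q (day_conv Q F G)"

text \<open>The transposes of \<open>day_fst\<close> and \<open>day_snd\<close>.\<close>

definition tensor_fst ::
  "('q, 'm) quantale_struct_scheme \<Rightarrow> ('q, 's) psh \<Rightarrow> ('q, 't) psh \<Rightarrow>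
     'q \<Rightarrow> ('q, ('q \<times> 'q \<times> 's \<times> 't) set) sh_term set \<Rightarrow> 's" where
  "tensor_fst Q F G = sheafify_ext Q (day_conv Q F G) F (day_fst F)"

definition tensor_snd ::
  "('q, 'm) quantale_struct_scheme \<Rightarrow> ('q, 's) psh \<Rightarrow> ('q, 't) psh \<Rightarrow>
     'q \<Rightarrow> ('q, ('q \<times> 'q \<times> 's \<times> 't) set) sh_term set \<Rightarrow> 't" where
  "tensor_snd Q F G = sheafify_ext Q (day_conv Q F G) G (day_snd G)"

definition equalizer :: "('q, 's) psh \<Rightarrow> ('q \<Rightarrow> 's \<Rightarrow> 't) \<Rightarrow> ('q \<Rightarrow> 's \<Rightarrow> 't) \<Rightarrow> ('q, 's) psh" where
  "equalizer F f g = F\<lparr>sec := (\<lambda>u. {x \<in> sec F u. f u x = g u x})\<rparr>"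

text \<open>\<open>sub_mult Q F A\<^sub>0 A\<^sub>1\<close> is \<open>[\<phi>\<^sub>0] * [\<phi>\<^sub>1]\<close>: for representatives \<open>\<phi>\<^sub>i: F\<^sub>i \<rightarrow> F\<close> of \<open>A\<^sub>i\<close>, the least
  subobject of \<open>F\<close> through which \<open>F\<^sub>0 \<otimes>\<^sub>F F\<^sub>1 \<rightarrow> F\<^sub>0 \<otimes> F\<^sub>1 \<rightrightarrows> F\<close> factors. The inclusion of the
  equalizer into \<open>F\<^sub>0 \<otimes> F\<^sub>1\<close> is the identity on sections.\<close>

definition sub_mult ::
  "('q, 'm) quantale_struct_scheme \<Rightarrow> ('q, 'u) psh \<Rightarrow>
     ('q, 'u) mono_into set \<Rightarrow> ('q, 'u) mono_into set \<Rightarrow> ('q, 'u) mono_into set" where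
  "sub_mult Q F A\<^sub>0 A\<^sub>1 =
     (let (F\<^sub>0, \<phi>\<^sub>0) = (SOME m. m \<in> A\<^sub>0);
          (F\<^sub>1, \<phi>\<^sub>1) = (SOME m. m \<in> A\<^sub>1);
          f\<^sub>0 = (\<lambda>u. \<phi>\<^sub>0 u \<circ> tensor_fst Q F\<^sub>0 F\<^sub>1 u);
          f\<^sub>1 = (\<lambda>u. \<phi>\<^sub>1 u \<circ> tensor_snd Q F\<^sub>0 F\<^sub>1 u);
          E = equalizer (sheaf_tensor Q F\<^sub>0 F\<^sub>1) f\<^sub>0 f\<^sub>1
      in THE C. C \<in> Sub Q F \<and> (\<exists>m\<in>C. factors_through Q E f\<^sub>0 m) \<and>
           (\<forall>D\<in>Sub Q F. (\<exists>m\<in>D. factors_through Q E f\<^sub>0 m) \<longrightarrow> sub_le Q C D))"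

definition Sub_quantale ::
  "('q, 'm) quantale_struct_scheme \<Rightarrow> ('q, 'u) psh \<Rightarrow> ('q, 'u) mono_into set quantale_struct" where
  "Sub_quantale Q F = \<lparr>carrier = Sub Q F, eq = (=), le = sub_le Q, qmult = sub_mult Q F\<rparr>"

definition k_map ::
  "('q, 'm) quantale_struct_scheme \<Rightarrow> ('q \<Rightarrow> 'q \<Rightarrow> 'u) \<Rightarrow> 'q \<Rightarrow> 'q \<Rightarrow> ('q, 'u) mono_into set" where
  "k_map Q arr a q =
     mono_iso Q (representable Q arr a) `` {(representable Q arr q, representable_map arr a)}"

end

theory Submission
  imports Defs
begin

text \<open>Every section set of \<open>Q(-, a)\<close> has at most one element, so a subobject of \<open>Q(-, a)\<close> is
  determined by the set of all \<open>u\<close> over which it has a section, and factorization is inclusion of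
  these sets. The gluing condition makes this set a principal down-set: compatibility is automatic, so
  there is a section over the supremum. The tensor product of subobjects with supports
  \<open>[0, p]\<close> and \<open>[0, q]\<close> has support \<open>[0, p \<odot> q]\<close>: the Day convolution has this support by monotonicity
  of \<open>\<odot>\<close>, and sheafification does not enlarge it, because the Day convolution maps to the sheaf
  \<open>Q(-, p \<odot> q)\<close>. The equalizer condition is vacuous, and the quantale structure of \<open>[0, a]\<close> is
  transported along \<open>k\<^sub>a\<close>.\<close>

section \<open>Transport of quantale structures\<close>

text \<open>\<open>sup\<close> is a choice among the least upper bounds; antisymmetry leaves only
  one candidate, so exhibiting any least upper bound computes it.\<close>

lemma (in partial_order) sup_eqI: "least L s (Upper L A) \<Longrightarrow> \<Squnion> A = s"
  unfolding sup_def by (blast intro: some_equality least_unique)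

lemma (in complete_lattice) least_sup: "A \<subseteq> carrier L \<Longrightarrow> least L (\<Squnion> A) (Upper L A)"
  using sup_exists sup_eqI by metis

text \<open>Comparable elements satisfy \<open>\<Squnion>{x, y} = y\<close>, so distributivity over
  two-element joins yields monotonicity in each argument; the two steps are composed through
  \<open>c \<odot> b\<close>.\<close>

lemma (in quantale) qmult_mono:
  assumes "a \<in> carrier Q" "b \<in> carrier Q" "c \<in> carrier Q" "d \<in> carrier Q" "a \<sqsubseteq> c" "b \<sqsubseteq> d"
  shows "a \<odot> b \<sqsubseteq> c \<odot> d"
proof -
  have join: "\<Squnion>{x, y} = y" if "x \<in> carrier Q" "y \<in> carrier Q" "x \<sqsubseteq> y" for x y
    using that by (intro sup_eqI least_UpperI) auto
  have "c \<odot> b = \<Squnion>{a \<odot> b, c \<odot> b}"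
    using qmult_sup_left[of b "{a, c}"] join[OF assms(1,3,5)] assms by simp
  then have 1: "a \<odot> b \<sqsubseteq> c \<odot> b"
    using sup_upper[of "{a \<odot> b, c \<odot> b}" "a \<odot> b"] assms by simp
  have "c \<odot> d = \<Squnion>{c \<odot> b, c \<odot> d}"
    using qmult_sup_right[of c "{b, d}"] join[OF assms(2,4,6)] assms by simp
  then have "c \<odot> b \<sqsubseteq> c \<odot> d"
    using sup_upper[of "{c \<odot> b, c \<odot> d}" "c \<odot> b"] assms by simp
  then show ?thesis using 1 assms by (blast intro: le_trans)
qed

section \<open>Order isomorphisms and the transport of suprema and multiplication\<close>

lemma poset_isoI:
  assumes "partial_order P" "eq R = (=)" "bij_betw f (carrier P) (carrier R)"
    and "\<And>x y. \<lbrakk>x \<in> carrier P; y \<in> carrier P\<rbrakk> \<Longrightarrow> f x \<sqsubseteq>\<^bsub>R\<^esub> f y \<longleftrightarrow> x \<sqsubseteq>\<^bsub>P\<^esub> y"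
  shows "poset_iso P R f"
proof -
  interpret P: partial_order P by fact
  have R: "carrier R = f ` carrier P" using assms(3) by (simp add: bij_betw_imp_surj_on)
  \<comment> \<open>Every element of \<open>R\<close> is a value of \<open>f\<close>, and
    \<open>f\<close> preserves and reflects the order, so the order laws are read off from
    \<open>P\<close>.\<close>
  have "partial_order R"
    by standard (auto simp: assms(2,4) R intro: P.le_trans dest: P.le_antisym)
  then show ?thesis unfolding poset_iso_def using assms by simp
qed

lemma poset_isoD:
  assumes "poset_iso P R f"
  shows "carrier R = f ` carrier P"
    and "\<lbrakk>x \<in> carrier P; y \<in> carrier P\<rbrakk> \<Longrightarrow> f x \<sqsubseteq>\<^bsub>R\<^esub> f y \<longleftrightarrow> x \<sqsubseteq>\<^bsub>P\<^esub> y"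
proof -
  have "bij_betw f (carrier P) (carrier R)" using assms unfolding poset_iso_def by blast
  then show "carrier R = f ` carrier P" by (simp add: bij_betw_imp_surj_on)
qed (use assms in \<open>simp add: poset_iso_def\<close>)

text \<open>An order isomorphism carries the set of upper bounds of \<open>A\<close> onto the set of
  upper bounds of the image, and likewise for lower bounds; extremal elements of these sets then
  correspond.\<close>

lemma poset_iso_least_greatest:
  assumes "poset_iso P R f" "A \<subseteq> carrier P"
  shows "least P s (Upper P A) \<Longrightarrow> least R (f s) (Upper R (f ` A))"
    and "greatest P s (Lower P A) \<Longrightarrow> greatest R (f s) (Lower R (f ` A))"
proof -
  note R = poset_isoD(1)[OF assms(1)] and le = poset_isoD(2)[OF assms(1)]
  have "Upper R (f ` A) = f ` Upper P A" "Lower R (f ` A) = f ` Lower P A"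
  proof -
    \<comment> \<open>\<open>Upper\<close> and \<open>Lower\<close> intersect their argument with
      the carrier, so this intersection is removed first.\<close>
    have "f ` A \<inter> carrier R = f ` A" "A \<inter> carrier P = A" using assms(2) by (auto simp: R)
    moreover have "x \<in> carrier P" if "x \<in> A" for x using that assms(2) by blast
    ultimately show "Upper R (f ` A) = f ` Upper P A" "Lower R (f ` A) = f ` Lower P A"
      unfolding Upper_def Lower_def by (auto simp: R le intro!: imageI)
  qed
  then show "least P s (Upper P A) \<Longrightarrow> least R (f s) (Upper R (f ` A))"
    "greatest P s (Lower P A) \<Longrightarrow> greatest R (f s) (Lower R (f ` A))"
    unfolding least_def greatest_def using R le by (auto simp: subset_iff)
qed

text \<open>Every subset of \<open>carrier R\<close> is the image of a subset of
  \<open>carrier P\<close>, where the required bounds exist and can be pushed forward.\<close>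

lemma poset_iso_complete_lattice:
  assumes iso: "poset_iso P R f" and "complete_lattice P"
  shows "complete_lattice R"
proof -
  interpret P: complete_lattice P by fact
  interpret R: partial_order R using iso by (simp add: poset_iso_def)
  note R = poset_isoD(1)[OF iso]
  show ?thesis
    by (rule R.complete_latticeI; unfold R; erule subset_imageE;
        blast intro: poset_iso_least_greatest[OF iso] dest: P.sup_exists P.inf_exists)
qed

lemma poset_iso_sup:
  assumes iso: "poset_iso P R f" and P: "complete_lattice P" and A: "A \<subseteq> carrier P"
  shows "f (\<Squnion>\<^bsub>P\<^esub> A) = \<Squnion>\<^bsub>R\<^esub> (f ` A)"
proof -
  interpret R: partial_order R using iso by (simp add: poset_iso_def)
  show ?thesis
    using R.sup_eqI[OF poset_iso_least_greatest(1)[OF iso A complete_lattice.least_sup[OF P A]]] ..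
qed

text \<open>Elements and subsets of \<open>R\<close> are pulled back to \<open>P\<close> along the
  surjection \<open>f\<close>; rewriting with \<open>mult\<close> and \<open>poset_iso_sup\<close>
  from right to left then reduces each law of \<open>R\<close> to the same law of
  \<open>P\<close>.\<close>

lemma poset_iso_quantale:
  assumes iso: "poset_iso P R f" and "quantale P"
    and mult: "\<And>x y. \<lbrakk>x \<in> carrier P; y \<in> carrier P\<rbrakk> \<Longrightarrow> f (x \<odot>\<^bsub>P\<^esub> y) = f x \<odot>\<^bsub>R\<^esub> f y"
  shows "quantale R"
proof -
  interpret P: quantale P by fact
  interpret R: complete_lattice R
    by (rule poset_iso_complete_lattice[OF iso P.complete_lattice_axioms])
  note R = poset_isoD(1)[OF iso]
  note sup = poset_iso_sup[OF iso P.complete_lattice_axioms, symmetric]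
  show ?thesis
  proof unfold_locales
    fix x y assume "x \<in> carrier R" "y \<in> carrier R"
    then show "x \<odot>\<^bsub>R\<^esub> y \<in> carrier R" unfolding R by (auto simp flip: mult)
  next
    fix x y z assume "x \<in> carrier R" "y \<in> carrier R" "z \<in> carrier R"
    then show "x \<odot>\<^bsub>R\<^esub> y \<odot>\<^bsub>R\<^esub> z = x \<odot>\<^bsub>R\<^esub> (y \<odot>\<^bsub>R\<^esub> z)"
      unfolding R by (auto simp: P.qmult_assoc simp flip: mult)
  next
    fix x B assume "x \<in> carrier R" "B \<subseteq> carrier R"
    then obtain p A where x: "p \<in> carrier P" "x = f p" and B: "A \<subseteq> carrier P" "B = f ` A"
      unfolding R subset_image_iff by blast
    \<comment> \<open>The translates of \<open>B\<close> by \<open>x\<close> are the images of the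
      translates of \<open>A\<close> by \<open>p\<close>, so that their suprema can be computed in
      \<open>P\<close>.\<close>
    have "(\<lambda>b. x \<odot>\<^bsub>R\<^esub> b) ` B = f ` (\<lambda>b. p \<odot>\<^bsub>P\<^esub> b) ` A"
      "(\<lambda>b. b \<odot>\<^bsub>R\<^esub> x) ` B = f ` (\<lambda>b. b \<odot>\<^bsub>P\<^esub> p) ` A"
      unfolding x(2) B(2) image_image using x(1) B(1)
      by (auto intro!: image_cong simp: mult subset_iff)
    moreover have "(\<lambda>b. p \<odot>\<^bsub>P\<^esub> b) ` A \<subseteq> carrier P" "(\<lambda>b. b \<odot>\<^bsub>P\<^esub> p) ` A \<subseteq> carrier P"
      using x(1) B(1) by auto
    ultimately show "x \<odot>\<^bsub>R\<^esub> \<Squnion>\<^bsub>R\<^esub> B = \<Squnion>\<^bsub>R\<^esub> ((\<lambda>b. x \<odot>\<^bsub>R\<^esub> b) ` B)"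
      "\<Squnion>\<^bsub>R\<^esub> B \<odot>\<^bsub>R\<^esub> x = \<Squnion>\<^bsub>R\<^esub> ((\<lambda>b. b \<odot>\<^bsub>R\<^esub> x) ` B)"
      using x B P.qmult_sup_right P.qmult_sup_left by (simp_all add: sup flip: mult)
  qed
qed

text \<open>Since each element and each subset of \<open>R\<close> is an image under
  \<open>f\<close>, the inverse inherits preservation of suprema and products from \<open>f\<close>
  by cancellation.\<close>

lemma poset_iso_quantale_iso:
  assumes iso: "poset_iso P R f" and P: "quantale P"
    and mult: "\<And>x y. \<lbrakk>x \<in> carrier P; y \<in> carrier P\<rbrakk> \<Longrightarrow> f (x \<odot>\<^bsub>P\<^esub> y) = f x \<odot>\<^bsub>R\<^esub> f y"
  shows "quantale_iso P R f"
proof -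
  interpret P: quantale P by fact
  let ?g = "inv_into (carrier P) f"
  have RQ: "quantale R" by (rule poset_iso_quantale[OF iso P]) (rule mult)
  have bij: "bij_betw f (carrier P) (carrier R)" using iso unfolding poset_iso_def by simp
  note R = poset_isoD(1)[OF iso]
  have gf: "?g (f x) = x" if "x \<in> carrier P" for x
    using bij that by (simp add: bij_betw_inv_into_left)
  note sup = poset_iso_sup[OF iso P.complete_lattice_axioms]
  have "?g (\<Squnion>\<^bsub>R\<^esub> B) = \<Squnion>\<^bsub>P\<^esub> (?g ` B)" if "B \<subseteq> carrier R" for B
  proof -
    have "B \<subseteq> f ` carrier P" using that by (simp add: R)
    then obtain A where A: "A \<subseteq> carrier P" "B = f ` A" by (meson subset_imageE)
    have "?g ` f ` A = (\<lambda>x. x) ` A"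
      unfolding image_image by (rule image_cong[OF refl]) (use A(1) gf in blast)
    then show ?thesis unfolding A(2) sup[OF A(1), symmetric] using gf P.sup_closed[OF A(1)] by simp
  qed
  moreover have "?g (x \<odot>\<^bsub>R\<^esub> y) = ?g x \<odot>\<^bsub>P\<^esub> ?g y" if "x \<in> carrier R" "y \<in> carrier R" for x y
    using that unfolding R by (auto simp: gf simp flip: mult)
  moreover have "?g \<in> carrier R \<rightarrow> carrier P" unfolding R by (auto simp: gf)
  ultimately have "quantale_hom R P ?g"
    unfolding quantale_hom_def using P RQ by blast
  moreover have "quantale_hom P R f"
    unfolding quantale_hom_def
  proof (intro conjI P RQ allI ballI impI)
    show "f \<in> carrier P \<rightarrow> carrier R" by (auto simp: R)
  qed (simp_all only: sup mult)
  ultimately show ?thesis using bij unfolding quantale_iso_def by blast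
qed

lemma poset_iso_commutative:
  assumes "poset_iso P R f" "commutative_quantale P"
    and "\<And>x y. \<lbrakk>x \<in> carrier P; y \<in> carrier P\<rbrakk> \<Longrightarrow> f (x \<odot>\<^bsub>P\<^esub> y) = f x \<odot>\<^bsub>R\<^esub> f y"
  shows "commutative_quantale R"
proof -
  note R = poset_isoD(1)[OF assms(1)]
  have "quantale R"
    by (rule poset_iso_quantale[OF assms(1)])
      (use assms(2,3) in \<open>auto simp: commutative_quantale_def\<close>)
  then show ?thesis
    using assms(2) unfolding commutative_quantale_def R by (auto simp flip: assms(3))
qed

lemma poset_iso_semicartesian:
  assumes "poset_iso P R f" "semicartesian_quantale P"
    and "\<And>x y. \<lbrakk>x \<in> carrier P; y \<in> carrier P\<rbrakk> \<Longrightarrow> f (x \<odot>\<^bsub>P\<^esub> y) = f x \<odot>\<^bsub>R\<^esub> f y"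
  shows "semicartesian_quantale R"
proof -
  interpret P: quantale P using assms(2) by (simp add: semicartesian_quantale_def)
  note R = poset_isoD(1)[OF assms(1)] and le = poset_isoD(2)[OF assms(1)]
  have "quantale R"
    by (rule poset_iso_quantale[OF assms(1) P.quantale_axioms]) (rule assms(3))
  then show ?thesis
    using assms(2) unfolding semicartesian_quantale_def R by (auto simp: le simp flip: assms(3))
qed

section \<open>The quantale \<open>[0, a]\<close>\<close>

lemma down_interval_simps [simp]:
  "carrier (down_interval Q a) = {b \<in> carrier Q. b \<sqsubseteq>\<^bsub>Q\<^esub> a}"
  "eq (down_interval Q a) = (=)" "le (down_interval Q a) = le Q"
  "qmult (down_interval Q a) = qmult Q"
  by (simp_all add: down_interval_def)

text \<open>Suprema agree with those of \<open>Q\<close>, because \<open>a\<close> bounds them, and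
  products stay in the interval because \<open>x \<odot> y \<sqsubseteq> x \<sqsubseteq> a\<close>.
  The distributive laws are thus instances of those of \<open>Q\<close>.\<close>

lemma down_interval_semicartesian_quantale:
  assumes sc: "semicartesian_quantale Q" and a: "a \<in> carrier Q"
  shows "semicartesian_quantale (down_interval Q a)"
proof -
  let ?D = "down_interval Q a"
  interpret quantale Q using sc by (simp add: semicartesian_quantale_def)
  have dot: "x \<odot>\<^bsub>Q\<^esub> y \<sqsubseteq>\<^bsub>Q\<^esub> x" "x \<odot>\<^bsub>Q\<^esub> y \<sqsubseteq>\<^bsub>Q\<^esub> y" if "x \<in> carrier Q" "y \<in> carrier Q" for x y
    using sc that unfolding semicartesian_quantale_def by auto
  interpret D: partial_order ?D
    by standard (auto intro: le_trans)
  have sup_le: "\<Squnion>\<^bsub>Q\<^esub> A \<sqsubseteq>\<^bsub>Q\<^esub> a" if "A \<subseteq> carrier ?D" for A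
    using that a by (intro sup_least) auto
  have lst: "least ?D (\<Squnion>\<^bsub>Q\<^esub> A) (Upper ?D A)" if A: "A \<subseteq> carrier ?D" for A
  proof (rule least_UpperI)
    have A': "A \<subseteq> carrier Q" using A by auto
    show "\<Squnion>\<^bsub>Q\<^esub> A \<in> carrier ?D" using sup_le[OF A] sup_closed[OF A'] by simp
    show "x \<sqsubseteq>\<^bsub>?D\<^esub> \<Squnion>\<^bsub>Q\<^esub> A" if "x \<in> A" for x using sup_upper[OF A' that] by simp
    show "\<Squnion>\<^bsub>Q\<^esub> A \<sqsubseteq>\<^bsub>?D\<^esub> y" if "y \<in> Upper ?D A" for y
      using that A A' by (auto intro!: sup_least simp: Upper_def)
  qed (rule A)
  have sup: "\<Squnion>\<^bsub>?D\<^esub> A = \<Squnion>\<^bsub>Q\<^esub> A" if "A \<subseteq> carrier ?D" for A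
    by (rule D.sup_eqI[OF lst[OF that]])
  interpret D: complete_lattice ?D
  proof (rule D.complete_latticeI)
    fix A assume A: "A \<subseteq> carrier ?D"
    then show "\<exists>s. least ?D s (Upper ?D A)" using lst by blast
    \<comment> \<open>Adding \<open>a\<close> keeps the infimum inside the interval; for empty
      \<open>A\<close> it makes the infimum \<open>a\<close> instead of the top of
      \<open>Q\<close>.\<close>
    have A': "insert a A \<subseteq> carrier Q" using A a by auto
    have "greatest ?D (\<Sqinter>\<^bsub>Q\<^esub> (insert a A)) (Lower ?D A)"
    proof (rule greatest_LowerI)
      show "\<Sqinter>\<^bsub>Q\<^esub> (insert a A) \<in> carrier ?D" using inf_lower[OF A'] inf_closed[OF A'] by simp
      show "\<Sqinter>\<^bsub>Q\<^esub> (insert a A) \<sqsubseteq>\<^bsub>?D\<^esub> x" if "x \<in> A" for x using inf_lower[OF A'] that by simp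
      show "y \<sqsubseteq>\<^bsub>?D\<^esub> \<Sqinter>\<^bsub>Q\<^esub> (insert a A)" if "y \<in> Lower ?D A" for y
        using that A A' by (auto intro!: inf_greatest simp: Lower_def)
    qed (rule A)
    then show "\<exists>i. greatest ?D i (Lower ?D A)" ..
  qed
  have mult: "x \<odot>\<^bsub>Q\<^esub> y \<in> carrier ?D" if "x \<in> carrier ?D" "y \<in> carrier ?D" for x y
    using that a dot(1)[of x y] by (auto intro: le_trans)
  have "quantale ?D"
  proof unfold_locales
    fix x B assume x: "x \<in> carrier ?D" and B: "B \<subseteq> carrier ?D"
    then have "(\<lambda>b. x \<odot>\<^bsub>Q\<^esub> b) ` B \<subseteq> carrier ?D" "(\<lambda>b. b \<odot>\<^bsub>Q\<^esub> x) ` B \<subseteq> carrier ?D"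
      using mult by blast+
    moreover have "x \<in> carrier Q" "B \<subseteq> carrier Q" using x B by auto
    ultimately show "x \<odot>\<^bsub>?D\<^esub> \<Squnion>\<^bsub>?D\<^esub> B = \<Squnion>\<^bsub>?D\<^esub> ((\<lambda>b. x \<odot>\<^bsub>?D\<^esub> b) ` B)"
      "\<Squnion>\<^bsub>?D\<^esub> B \<odot>\<^bsub>?D\<^esub> x = \<Squnion>\<^bsub>?D\<^esub> ((\<lambda>b. b \<odot>\<^bsub>?D\<^esub> x) ` B)"
      using B qmult_sup_right qmult_sup_left by (simp_all only: sup down_interval_simps)
  qed (use mult qmult_assoc in auto)
  then show ?thesis unfolding semicartesian_quantale_def using dot by simp
qed

section \<open>Subobjects of a representable sheaf\<close>

text \<open>The value type of the sections is arbitrary, so subobjects, Day convolutions and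
  sheafifications can all be compared by their supports.\<close>

definition support :: "('q, 'm) quantale_struct_scheme \<Rightarrow> ('q, 's) psh \<Rightarrow> 'q set" where
  "support Q F = {u \<in> carrier Q. sec F u \<noteq> {}}"

lemma representable_sec:
  "x \<in> sec (representable Q arr a) u \<longleftrightarrow> x = arr u a \<and> u \<in> carrier Q \<and> u \<sqsubseteq>\<^bsub>Q\<^esub> a"
  by (simp add: representable_def)

lemma representable_res [simp]: "res (representable Q arr a) u v x = arr v a"
  by (simp add: representable_def)

lemma support_representable: "support Q (representable Q arr a) = {u \<in> carrier Q. u \<sqsubseteq>\<^bsub>Q\<^esub> a}"
  unfolding support_def by (auto simp: representable_def)

lemma nat_trans_support: "nat_trans Q F G f \<Longrightarrow> support Q F \<subseteq> support Q G"
  unfolding nat_trans_def support_def by blast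

lemma nat_trans_sec: "\<lbrakk>nat_trans Q F G f; u \<in> carrier Q; x \<in> sec F u\<rbrakk> \<Longrightarrow> f u x \<in> sec G u"
  unfolding nat_trans_def by blast

text \<open>The target has only one possible section over each \<open>u\<close>; naturality is
  automatic once that section exists.\<close>

lemma nat_trans_representable:
  assumes "support Q F \<subseteq> {u \<in> carrier Q. u \<sqsubseteq>\<^bsub>Q\<^esub> a}"
  shows "nat_trans Q F (representable Q arr a) (\<lambda>u _. arr u a)"
  using assms unfolding nat_trans_def support_def by (auto simp: representable_sec)

section \<open>Monomorphisms into \<open>Q(-, a)\<close> and their supports\<close>

locale representable_sheaf =
  fixes Q :: "('q, 'm) quantale_struct_scheme" and arr :: "'q \<Rightarrow> 'q \<Rightarrow> 'u" and a :: 'q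
  assumes semicartesian: "semicartesian_quantale Q" and a [simp]: "a \<in> carrier Q"
begin

sublocale quantale Q using semicartesian by (simp add: semicartesian_quantale_def)

abbreviation Y :: "('q, 'u) psh" where "Y \<equiv> representable Q arr a"

lemma dot_le:
  assumes "x \<in> carrier Q" "y \<in> carrier Q"
  shows "x \<odot>\<^bsub>Q\<^esub> y \<sqsubseteq>\<^bsub>Q\<^esub> x" "x \<odot>\<^bsub>Q\<^esub> y \<sqsubseteq>\<^bsub>Q\<^esub> y"
  using semicartesian assms unfolding semicartesian_quantale_def by auto

text \<open>Any two sections of \<open>G\<close> over \<open>u\<close> have the same image, the only
  possible section \<open>arr u a\<close> of \<open>Y\<close>, and monomorphisms are injective on
  sections.\<close>

lemma mono_intoD:
  assumes "(G, \<phi>) \<in> monos_into Q Y"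
  shows "is_sheaf Q G" "is_presheaf Q G" "nat_trans Q G Y \<phi>"
    and "\<And>u x y. \<lbrakk>u \<in> carrier Q; x \<in> sec G u; y \<in> sec G u\<rbrakk> \<Longrightarrow> x = y"
proof -
  have m: "is_sheaf Q G" "nat_trans Q G Y \<phi>" "\<forall>u\<in>carrier Q. inj_on (\<phi> u) (sec G u)"
    using assms sheaf_mono_iff_inj[OF semicartesian] unfolding monos_into_def by auto
  show "is_sheaf Q G" "is_presheaf Q G" "nat_trans Q G Y \<phi>" using m unfolding is_sheaf_def by auto
  fix u x y assume u: "u \<in> carrier Q" and xy: "x \<in> sec G u" "y \<in> sec G u"
  then have "\<phi> u x = \<phi> u y"
    using nat_trans_sec[OF m(2) u] representable_sec by metis
  then show "x = y" using m(3) u xy by (auto dest: inj_onD)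
qed

text \<open>The witness \<open>q\<close> is the supremum of the support. Gluing arbitrarily chosen
  sections shows that \<open>q\<close> itself lies in the support, and restriction gives everything
  below \<open>q\<close>. The empty family is covered as well: it glues to a section over the
  bottom.\<close>

lemma support_mono_into:
  assumes "(G, \<phi>) \<in> monos_into Q Y"
  obtains q where "q \<in> carrier (down_interval Q a)" "support Q G = {u \<in> carrier Q. u \<sqsubseteq>\<^bsub>Q\<^esub> q}"
proof
  note G = mono_intoD[OF assms]
  let ?S = "support Q G" and ?s = "\<lambda>u. SOME x. x \<in> sec G u"
  let ?q = "\<Squnion>\<^bsub>Q\<^esub> ?S"
  have S: "?S \<subseteq> carrier Q" unfolding support_def by blast
  have le: "?S \<subseteq> {u \<in> carrier Q. u \<sqsubseteq>\<^bsub>Q\<^esub> a}"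
    using nat_trans_support[OF G(3)] support_representable by metis
  have s: "?s u \<in> sec G u" if "u \<in> ?S" for u
    using that unfolding support_def by (simp add: some_in_eq)
  show q: "?q \<in> carrier (down_interval Q a)"
    using sup_closed[OF S] sup_least[OF S, of a] le by force
  have "compatible Q G ?S (\<lambda>u. u) ?s"
    unfolding compatible_def
  proof (intro conjI ballI)
    fix u v assume u: "u \<in> ?S" and v: "v \<in> ?S"
    then have c: "u \<in> carrier Q" "v \<in> carrier Q" using S by auto
    \<comment> \<open>Both sides are sections of \<open>G\<close> over \<open>u \<odot> v\<close>,
      where there is at most one.\<close>
    show "res G u (u \<odot>\<^bsub>Q\<^esub> v) (?s u) = res G v (u \<odot>\<^bsub>Q\<^esub> v) (?s v)"
      using c dot_le[OF c] s[OF u] s[OF v] by (intro G(4)[of "u \<odot>\<^bsub>Q\<^esub> v"] presheaf_res_closed[OF G(2)]) auto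
  qed (use S s in blast)+
  then obtain z where z: "z \<in> sec G ?q"
    using sheaf_any_index[OF G(1)] unfolding glues_def by fastforce
  show "?S = {u \<in> carrier Q. u \<sqsubseteq>\<^bsub>Q\<^esub> ?q}"
  proof (intro equalityI subsetI)
    fix u assume "u \<in> {u \<in> carrier Q. u \<sqsubseteq>\<^bsub>Q\<^esub> ?q}"
    then show "u \<in> ?S"
      using presheaf_res_closed[OF G(2) sup_closed[OF S] _ _ z, of u] unfolding support_def by auto
  qed (use S sup_upper[OF S] in blast)
qed

text \<open>Choosing a section of the domain of \<open>m\<close> wherever \<open>E\<close> has one
  gives the factor. \<open>E\<close> may have many sections; uniqueness of sections in the domain of
  \<open>m\<close> gives naturality, and uniqueness in \<open>Y\<close> gives the commuting
  triangle.\<close>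

lemma factors_through_iff:
  assumes E: "is_presheaf Q E" and f: "\<And>u x. \<lbrakk>u \<in> carrier Q; x \<in> sec E u\<rbrakk> \<Longrightarrow> f u x \<in> sec Y u"
    and m: "m \<in> monos_into Q Y"
  shows "factors_through Q E f m \<longleftrightarrow> support Q E \<subseteq> support Q (fst m)"
proof
  show "factors_through Q E f m \<Longrightarrow> support Q E \<subseteq> support Q (fst m)"
    unfolding factors_through_def using nat_trans_support by blast
next
  assume S: "support Q E \<subseteq> support Q (fst m)"
  note G = mono_intoD[of "fst m" "snd m", simplified, OF m]
  let ?g = "\<lambda>u _. SOME y. y \<in> sec (fst m) u"
  have g: "?g u x \<in> sec (fst m) u" if "u \<in> carrier Q" "x \<in> sec E u" for u and x :: 'a
    using S that unfolding support_def by (auto simp: some_in_eq)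
  have "nat_trans Q E (fst m) ?g"
    unfolding nat_trans_def
  proof (intro conjI ballI impI Pi_I g)
    fix u v x assume u: "u \<in> carrier Q" and v: "v \<in> carrier Q" "v \<sqsubseteq>\<^bsub>Q\<^esub> u" and x: "x \<in> sec E u"
    show "?g v (res E u v x) = res (fst m) u v (?g u x)"
      by (rule G(4)[OF v(1) g[OF v(1) presheaf_res_closed[OF E u v x]]
            presheaf_res_closed[OF G(2) u v g[OF u x]]])
  qed
  moreover have "nat_eq Q E (\<lambda>u. snd m u \<circ> ?g u) f"
    unfolding nat_eq_def
  proof (intro ballI)
    fix u x assume u: "u \<in> carrier Q" and x: "x \<in> sec E u"
    show "(snd m u \<circ> ?g u) x = f u x"
      using f[OF u x] nat_trans_sec[OF G(3) u g[OF u x]] by (simp add: representable_sec)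
  qed
  ultimately show "factors_through Q E f m" unfolding factors_through_def by blast
qed

text \<open>Equal supports give factorizations in both directions, and these are mutually inverse
  because the section sets of both domains have at most one element.\<close>

lemma mono_iso_iff:
  "(m, n) \<in> mono_iso Q Y \<longleftrightarrow>
     m \<in> monos_into Q Y \<and> n \<in> monos_into Q Y \<and> support Q (fst m) = support Q (fst n)"
proof -
  obtain G \<phi> H \<psi> where mn: "m = (G, \<phi>)" "n = (H, \<psi>)" by fastforce
  show ?thesis unfolding mn fst_conv
  proof (intro iffI conjI)
    assume "((G, \<phi>), (H, \<psi>)) \<in> mono_iso Q Y"
    then show "(G, \<phi>) \<in> monos_into Q Y" "(H, \<psi>) \<in> monos_into Q Y" "support Q G = support Q H"
      unfolding mono_iso_def using nat_trans_support by blast+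
  next
    assume *: "(G, \<phi>) \<in> monos_into Q Y \<and> (H, \<psi>) \<in> monos_into Q Y \<and> support Q G = support Q H"
    then have m: "(G, \<phi>) \<in> monos_into Q Y" and n: "(H, \<psi>) \<in> monos_into Q Y" by auto
    note G = mono_intoD[OF m] and H = mono_intoD[OF n]
    have "factors_through Q G \<phi> (H, \<psi>)" "factors_through Q H \<psi> (G, \<phi>)"
      using * factors_through_iff[OF G(2) nat_trans_sec[OF G(3)] n]
        factors_through_iff[OF H(2) nat_trans_sec[OF H(3)] m] by simp_all
    then obtain g h where g: "nat_trans Q G H g" "nat_eq Q G (\<lambda>u. \<psi> u \<circ> g u) \<phi>"
      and h: "nat_trans Q H G h" unfolding factors_through_def by auto
    have "h u (g u x) = x" if "u \<in> carrier Q" "x \<in> sec G u" for u x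
      by (rule G(4)[OF that(1) nat_trans_sec[OF h that(1) nat_trans_sec[OF g(1) that]] that(2)])
    moreover have "g u (h u x) = x" if "u \<in> carrier Q" "x \<in> sec H u" for u x
      by (rule H(4)[OF that(1) nat_trans_sec[OF g(1) that(1) nat_trans_sec[OF h that]] that(2)])
    ultimately have "nat_eq Q G (\<lambda>u. h u \<circ> g u) (\<lambda>u x. x)" "nat_eq Q H (\<lambda>u. g u \<circ> h u) (\<lambda>u x. x)"
      unfolding nat_eq_def by simp_all
    then show "((G, \<phi>), (H, \<psi>)) \<in> mono_iso Q Y"
      unfolding mono_iso_def using m n g h by blast
  qed
qed

lemma representable_mono:
  assumes "q \<in> carrier (down_interval Q a)"
  shows "(representable Q arr q, representable_map arr a) \<in> monos_into Q Y"
proof -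
  have q: "q \<in> carrier Q" "q \<sqsubseteq>\<^bsub>Q\<^esub> a" using assms by auto
  have "nat_trans Q (representable Q arr q) Y (\<lambda>u _. arr u a)"
    by (rule nat_trans_representable) (use q in \<open>auto simp: support_representable intro: le_trans\<close>)
  then show ?thesis
    unfolding monos_into_def sheaf_mono_iff_inj[OF semicartesian] representable_map_def
    using q representable_is_sheaf[OF semicartesian] by (auto simp: representable_sec inj_on_def)
qed

section \<open>The classes \<open>k_map Q arr a q\<close> and their order\<close>

lemma k_map_mem_iff:
  assumes "q \<in> carrier (down_interval Q a)"
  shows "m \<in> k_map Q arr a q \<longleftrightarrow>
    m \<in> monos_into Q Y \<and> support Q (fst m) = {u \<in> carrier Q. u \<sqsubseteq>\<^bsub>Q\<^esub> q}"
  unfolding k_map_def by (auto simp: mono_iso_iff representable_mono[OF assms] support_representable)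

lemma representable_mem_k_map:
  assumes "q \<in> carrier (down_interval Q a)"
  shows "(representable Q arr q, representable_map arr a) \<in> k_map Q arr a q"
  by (simp add: k_map_mem_iff[OF assms] representable_mono[OF assms] support_representable)

text \<open>This supplies surjectivity of \<open>k_map\<close>: the support of a monomorphism is a
  principal down-set, and the support determines the class.\<close>

lemma Sub_eq: "Sub Q Y = k_map Q arr a ` carrier (down_interval Q a)"
proof (intro equalityI subsetI)
  fix C assume "C \<in> Sub Q Y"
  then obtain G \<phi> where m: "(G, \<phi>) \<in> monos_into Q Y" and C: "C = mono_iso Q Y `` {(G, \<phi>)}"
    unfolding Sub_def by (auto elim!: quotientE)
  obtain q where q: "q \<in> carrier (down_interval Q a)" "support Q G = {u \<in> carrier Q. u \<sqsubseteq>\<^bsub>Q\<^esub> q}"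
    using m by (rule support_mono_into)
  have "C = k_map Q arr a q"
    using m q(2) unfolding C by (auto simp: mono_iso_iff k_map_mem_iff[OF q(1)])
  then show "C \<in> k_map Q arr a ` carrier (down_interval Q a)" using q(1) by blast
next
  fix C assume "C \<in> k_map Q arr a ` carrier (down_interval Q a)"
  then show "C \<in> Sub Q Y" unfolding Sub_def k_map_def using representable_mono by (auto intro: quotientI)
qed

text \<open>All members of the class have the same support, so factoring through one of them is
  factoring through any; the representable member shows that the class is nonempty.\<close>

lemma factors_through_k_map:
  assumes "is_presheaf Q E" "\<And>u x. \<lbrakk>u \<in> carrier Q; x \<in> sec E u\<rbrakk> \<Longrightarrow> f u x \<in> sec Y u"
    and q: "q \<in> carrier (down_interval Q a)"
  shows "(\<exists>m\<in>k_map Q arr a q. factors_through Q E f m) \<longleftrightarrow> support Q E \<subseteq> {u \<in> carrier Q. u \<sqsubseteq>\<^bsub>Q\<^esub> q}"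
proof -
  note representable_mem_k_map[OF q]
  moreover have "factors_through Q E f m \<longleftrightarrow> support Q E \<subseteq> {u \<in> carrier Q. u \<sqsubseteq>\<^bsub>Q\<^esub> q}"
    if "m \<in> k_map Q arr a q" for m
  proof -
    have m: "m \<in> monos_into Q Y" "support Q (fst m) = {u \<in> carrier Q. u \<sqsubseteq>\<^bsub>Q\<^esub> q}"
      using that k_map_mem_iff[OF q] by auto
    show ?thesis using factors_through_iff[OF assms(1,2) m(1)] by (simp add: m(2))
  qed
  ultimately show ?thesis by blast
qed

lemma down_set_subset_iff:
  "\<lbrakk>p \<in> carrier Q; q \<in> carrier Q\<rbrakk> \<Longrightarrow>
    {u \<in> carrier Q. u \<sqsubseteq>\<^bsub>Q\<^esub> p} \<subseteq> {u \<in> carrier Q. u \<sqsubseteq>\<^bsub>Q\<^esub> q} \<longleftrightarrow> p \<sqsubseteq>\<^bsub>Q\<^esub> q"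
  by (auto intro: le_trans)

lemma sub_le_k_map:
  assumes p: "p \<in> carrier (down_interval Q a)" and q: "q \<in> carrier (down_interval Q a)"
  shows "sub_le Q (k_map Q arr a p) (k_map Q arr a q) \<longleftrightarrow> p \<sqsubseteq>\<^bsub>Q\<^esub> q"
proof -
  have "(\<exists>m\<in>k_map Q arr a q. factors_through Q G \<phi> m) \<longleftrightarrow> p \<sqsubseteq>\<^bsub>Q\<^esub> q"
    if "(G, \<phi>) \<in> k_map Q arr a p" for G \<phi>
  proof -
    have m: "(G, \<phi>) \<in> monos_into Q Y" "support Q G = {u \<in> carrier Q. u \<sqsubseteq>\<^bsub>Q\<^esub> p}"
      using that k_map_mem_iff[OF p] by auto
    show ?thesis
      using factors_through_k_map[OF mono_intoD(2)[OF m(1)] nat_trans_sec[OF mono_intoD(3)[OF m(1)]] q]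
        down_set_subset_iff p q by (simp add: m(2))
  qed
  moreover note representable_mem_k_map[OF p]
  ultimately show ?thesis unfolding sub_le_def by blast
qed

lemma k_map_poset_iso: "poset_iso (down_interval Q a) (Sub_quantale Q Y) (k_map Q arr a)"
proof (rule poset_isoI)
  interpret D: quantale "down_interval Q a"
    using down_interval_semicartesian_quantale[OF semicartesian a] by (simp add: semicartesian_quantale_def)
  show "partial_order (down_interval Q a)" by (rule D.partial_order_axioms)
  have "inj_on (k_map Q arr a) (carrier (down_interval Q a))"
  proof (rule inj_onI)
    fix p q assume *: "p \<in> carrier (down_interval Q a)" "q \<in> carrier (down_interval Q a)"
      "k_map Q arr a p = k_map Q arr a q"
    then have "p \<sqsubseteq>\<^bsub>Q\<^esub> q" "q \<sqsubseteq>\<^bsub>Q\<^esub> p"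
      \<comment> \<open>The instance at \<open>p\<close>, \<open>p\<close> gives reflexivity of
        \<open>sub_le\<close> on the common class; the other two turn it into both
        inequalities.\<close>
      using sub_le_k_map[of p q] sub_le_k_map[of p p] sub_le_k_map[of q p] by auto
    then show "p = q" using * by auto
  qed
  then show "bij_betw (k_map Q arr a) (carrier (down_interval Q a)) (carrier (Sub_quantale Q Y))"
    unfolding bij_betw_def by (simp add: Sub_quantale_def Sub_eq)
qed (simp_all add: Sub_quantale_def sub_le_k_map)


section \<open>The product of subobjects\<close>

text \<open>The existence half of the universal property justifies the choice in
  \<open>sheafify_ext\<close>, so the tensor projections really are natural transformations.\<close>

lemma sheafify_ext_extends:
  assumes "is_presheaf Q P" "is_sheaf Q G" "nat_trans Q P G f"
  shows "extends_along_unit Q P G f (sheafify_ext Q P G f)"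
  unfolding sheafify_ext_def
  using someI_ex[OF extends_along_unit_exists[OF semicartesian assms]] .

lemma support_sheaf_tensor:
  assumes F: "is_sheaf Q F" "support Q F = {u \<in> carrier Q. u \<sqsubseteq>\<^bsub>Q\<^esub> p}" "p \<in> carrier Q"
    and G: "is_sheaf Q G" "support Q G = {u \<in> carrier Q. u \<sqsubseteq>\<^bsub>Q\<^esub> q}" "q \<in> carrier Q"
  shows "support Q (sheaf_tensor Q F G) = {u \<in> carrier Q. u \<sqsubseteq>\<^bsub>Q\<^esub> p \<odot>\<^bsub>Q\<^esub> q}"
proof -
  let ?P = "day_conv Q F G"
  have pq: "p \<odot>\<^bsub>Q\<^esub> q \<in> carrier Q" using F(3) G(3) by simp
  have P: "is_presheaf Q ?P" by (rule day_conv_is_presheaf[OF quantale_axioms])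
  have "support Q ?P = {w \<in> carrier Q. day_elts Q F G w \<noteq> {}}"
    unfolding support_def by (simp add: day_conv_def)
  also have "\<dots> = {w \<in> carrier Q. \<exists>u\<in>support Q F. \<exists>v\<in>support Q G. w \<sqsubseteq>\<^bsub>Q\<^esub> u \<odot>\<^bsub>Q\<^esub> v}"
    unfolding day_elts_def support_def by blast
  also have "\<dots> = {w \<in> carrier Q. w \<sqsubseteq>\<^bsub>Q\<^esub> p \<odot>\<^bsub>Q\<^esub> q}"
  proof (rule Collect_cong, rule conj_cong[OF HOL.refl])
    fix w assume w: "w \<in> carrier Q"
    show "(\<exists>u\<in>support Q F. \<exists>v\<in>support Q G. w \<sqsubseteq>\<^bsub>Q\<^esub> u \<odot>\<^bsub>Q\<^esub> v) \<longleftrightarrow> w \<sqsubseteq>\<^bsub>Q\<^esub> p \<odot>\<^bsub>Q\<^esub> q"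
    proof
      assume "\<exists>u\<in>support Q F. \<exists>v\<in>support Q G. w \<sqsubseteq>\<^bsub>Q\<^esub> u \<odot>\<^bsub>Q\<^esub> v"
      then obtain u v where u: "u \<in> carrier Q" "u \<sqsubseteq>\<^bsub>Q\<^esub> p" and v: "v \<in> carrier Q" "v \<sqsubseteq>\<^bsub>Q\<^esub> q"
        and le: "w \<sqsubseteq>\<^bsub>Q\<^esub> u \<odot>\<^bsub>Q\<^esub> v" unfolding F(2) G(2) by blast
      show "w \<sqsubseteq>\<^bsub>Q\<^esub> p \<odot>\<^bsub>Q\<^esub> q"
        by (rule le_trans[OF le qmult_mono]) (use u v w F(3) G(3) in simp_all)
    next
      assume "w \<sqsubseteq>\<^bsub>Q\<^esub> p \<odot>\<^bsub>Q\<^esub> q"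
      \<comment> \<open>The largest elements of the two supports serve as the witnesses.\<close>
      moreover have "p \<in> support Q F" "q \<in> support Q G" using F(2,3) G(2,3) by simp_all
      ultimately show "\<exists>u\<in>support Q F. \<exists>v\<in>support Q G. w \<sqsubseteq>\<^bsub>Q\<^esub> u \<odot>\<^bsub>Q\<^esub> v" by blast
    qed
  qed
  finally have S: "support Q ?P = {w \<in> carrier Q. w \<sqsubseteq>\<^bsub>Q\<^esub> p \<odot>\<^bsub>Q\<^esub> q}" .
  \<comment> \<open>This representable sheaf serves only as an upper bound for a support, so all
    arrows may bear the name \<open>()\<close>.\<close>
  let ?arr = "\<lambda>_ _. ()"
  have "nat_trans Q ?P (representable Q ?arr (p \<odot>\<^bsub>Q\<^esub> q)) (\<lambda>u _. ?arr u (p \<odot>\<^bsub>Q\<^esub> q))"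
    by (rule nat_trans_representable) (simp add: S)
  then obtain g where "nat_trans Q (sheafify Q ?P) (representable Q ?arr (p \<odot>\<^bsub>Q\<^esub> q)) g"
    using extends_along_unit_exists[OF semicartesian P representable_is_sheaf[OF semicartesian pq]]
    unfolding extends_along_unit_def by blast
  note nat_trans_support[OF this, unfolded support_representable]
  moreover have "support Q ?P \<subseteq> support Q (sheafify Q ?P)"
    by (rule nat_trans_support[OF sheafify_unit_nat[OF quantale_axioms P]])
  ultimately show ?thesis unfolding sheaf_tensor_def S by blast
qed

text \<open>The representatives picked by \<open>SOME\<close> are known only through their supports,
  which suffices: the classes through which the composite factors are those of the \<open>r\<close>
  above \<open>p \<odot> q\<close>, and the least of them is the class of
  \<open>p \<odot> q\<close>.\<close>

lemma sub_mult_k_map: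
  assumes p: "p \<in> carrier (down_interval Q a)" and q: "q \<in> carrier (down_interval Q a)"
  shows "sub_mult Q Y (k_map Q arr a p) (k_map Q arr a q) = k_map Q arr a (p \<odot>\<^bsub>Q\<^esub> q)"
proof -
  interpret D: quantale "down_interval Q a"
    using down_interval_semicartesian_quantale[OF semicartesian a] by (simp add: semicartesian_quantale_def)
  have pq: "p \<odot>\<^bsub>Q\<^esub> q \<in> carrier (down_interval Q a)" using D.qmult_closed[OF p q] by simp
  obtain F \<phi> where F: "(SOME m. m \<in> k_map Q arr a p) = (F, \<phi>)" by fastforce
  obtain G \<psi> where G: "(SOME m. m \<in> k_map Q arr a q) = (G, \<psi>)" by fastforce
  have "(F, \<phi>) \<in> k_map Q arr a p" "(G, \<psi>) \<in> k_map Q arr a q"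
    using someI[of "\<lambda>m. m \<in> k_map Q arr a p", OF representable_mem_k_map[OF p]]
      someI[of "\<lambda>m. m \<in> k_map Q arr a q", OF representable_mem_k_map[OF q]] unfolding F G .
  then have m: "(F, \<phi>) \<in> monos_into Q Y" "support Q F = {u \<in> carrier Q. u \<sqsubseteq>\<^bsub>Q\<^esub> p}"
    and n: "(G, \<psi>) \<in> monos_into Q Y" "support Q G = {u \<in> carrier Q. u \<sqsubseteq>\<^bsub>Q\<^esub> q}"
    using k_map_mem_iff[OF p] k_map_mem_iff[OF q] by auto
  note F' = mono_intoD[OF m(1)] and G' = mono_intoD[OF n(1)]
  let ?P = "day_conv Q F G" and ?T = "sheaf_tensor Q F G"
  define f\<^sub>0 where "f\<^sub>0 = (\<lambda>u. \<phi> u \<circ> tensor_fst Q F G u)"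
  define f\<^sub>1 where "f\<^sub>1 = (\<lambda>u. \<psi> u \<circ> tensor_snd Q F G u)"
  define E where "E = equalizer ?T f\<^sub>0 f\<^sub>1"
  have P: "is_presheaf Q ?P" by (rule day_conv_is_presheaf[OF quantale_axioms])
  have T: "is_presheaf Q ?T" unfolding sheaf_tensor_def by (rule sheafify_is_presheaf[OF quantale_axioms])
  have proj: "nat_trans Q ?T F (tensor_fst Q F G)" "nat_trans Q ?T G (tensor_snd Q F G)"
    using sheafify_ext_extends[OF P F'(1) day_projections_nat_trans(1)[OF semicartesian F'(2) G'(2)]]
      sheafify_ext_extends[OF P G'(1) day_projections_nat_trans(2)[OF semicartesian F'(2) G'(2)]]
    unfolding tensor_fst_def tensor_snd_def sheaf_tensor_def extends_along_unit_def by blast+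
  have f: "f\<^sub>0 u x \<in> sec Y u" "f\<^sub>1 u x \<in> sec Y u" if "u \<in> carrier Q" "x \<in> sec ?T u" for u x
    using nat_trans_sec[OF F'(3) that(1) nat_trans_sec[OF proj(1) that]]
      nat_trans_sec[OF G'(3) that(1) nat_trans_sec[OF proj(2) that]]
    by (simp_all add: f\<^sub>0_def f\<^sub>1_def)
  \<comment> \<open>Both values equal \<open>arr u a\<close>, so the equalizer is the whole tensor
    product.\<close>
  have eq: "f\<^sub>0 u x = f\<^sub>1 u x" if "u \<in> carrier Q" "x \<in> sec ?T u" for u x
    using f[OF that] by (simp add: representable_sec)
  have E_sec: "sec E u = sec ?T u" if "u \<in> carrier Q" for u
    unfolding E_def equalizer_def using eq[OF that] by auto
  have E_res: "res E = res ?T" by (simp add: E_def equalizer_def)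
  have E: "is_presheaf Q E" using T unfolding is_presheaf_def by (simp add: E_sec E_res cong: ball_cong)
  have "support Q E = support Q ?T" unfolding support_def using E_sec by auto
  then have E_supp: "support Q E = {u \<in> carrier Q. u \<sqsubseteq>\<^bsub>Q\<^esub> p \<odot>\<^bsub>Q\<^esub> q}"
    using support_sheaf_tensor[OF F'(1) m(2) _ G'(1) n(2)] p q by simp
  \<comment> \<open>This translates the universal property defining \<open>sub_mult\<close> into an
    order condition on \<open>r\<close>.\<close>
  have fac: "(\<exists>m\<in>k_map Q arr a r. factors_through Q E f\<^sub>0 m) \<longleftrightarrow> p \<odot>\<^bsub>Q\<^esub> q \<sqsubseteq>\<^bsub>Q\<^esub> r"
    if r: "r \<in> carrier (down_interval Q a)" for r
  proof -
    have "f\<^sub>0 u x \<in> sec Y u" if "u \<in> carrier Q" "x \<in> sec E u" for u x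
      using f(1)[OF that(1)] that by (simp add: E_sec)
    then have "(\<exists>m\<in>k_map Q arr a r. factors_through Q E f\<^sub>0 m) \<longleftrightarrow>
        support Q E \<subseteq> {u \<in> carrier Q. u \<sqsubseteq>\<^bsub>Q\<^esub> r}"
      by (rule factors_through_k_map[OF E _ r])
    also have "\<dots> \<longleftrightarrow> p \<odot>\<^bsub>Q\<^esub> q \<sqsubseteq>\<^bsub>Q\<^esub> r"
      unfolding E_supp by (rule down_set_subset_iff) (use pq r in simp_all)
    finally show ?thesis .
  qed
  have "sub_mult Q Y (k_map Q arr a p) (k_map Q arr a q) =
      (THE C. C \<in> Sub Q Y \<and> (\<exists>m\<in>C. factors_through Q E f\<^sub>0 m) \<and>
         (\<forall>D\<in>Sub Q Y. (\<exists>m\<in>D. factors_through Q E f\<^sub>0 m) \<longrightarrow> sub_le Q C D))"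
    unfolding sub_mult_def F G Let_def E_def f\<^sub>0_def f\<^sub>1_def by simp
  also have "\<dots> = k_map Q arr a (p \<odot>\<^bsub>Q\<^esub> q)"
  proof (rule the_equality)
    show "k_map Q arr a (p \<odot>\<^bsub>Q\<^esub> q) \<in> Sub Q Y \<and>
        (\<exists>m\<in>k_map Q arr a (p \<odot>\<^bsub>Q\<^esub> q). factors_through Q E f\<^sub>0 m) \<and>
        (\<forall>D\<in>Sub Q Y. (\<exists>m\<in>D. factors_through Q E f\<^sub>0 m) \<longrightarrow> sub_le Q (k_map Q arr a (p \<odot>\<^bsub>Q\<^esub> q)) D)"
      unfolding Sub_eq using pq fac[OF pq] fac sub_le_k_map[OF pq] by auto
  next
    fix C
    assume C: "C \<in> Sub Q Y \<and> (\<exists>m\<in>C. factors_through Q E f\<^sub>0 m) \<and>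
      (\<forall>D\<in>Sub Q Y. (\<exists>m\<in>D. factors_through Q E f\<^sub>0 m) \<longrightarrow> sub_le Q C D)"
    then obtain r where r: "r \<in> carrier (down_interval Q a)" "C = k_map Q arr a r"
      unfolding Sub_eq by blast
    have "p \<odot>\<^bsub>Q\<^esub> q \<sqsubseteq>\<^bsub>Q\<^esub> r" using C fac[OF r(1)] unfolding r(2) by blast
    \<comment> \<open>Minimality of \<open>C\<close> is applied to the class of
      \<open>p \<odot> q\<close>, through which the composite factors.\<close>
    moreover have "r \<sqsubseteq>\<^bsub>Q\<^esub> p \<odot>\<^bsub>Q\<^esub> q"
      using C fac[OF pq] pq sub_le_k_map[OF r(1) pq] unfolding r(2) Sub_eq by auto
    ultimately have "r = p \<odot>\<^bsub>Q\<^esub> q" using r(1) pq by (intro le_antisym) auto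
    then show "C = k_map Q arr a (p \<odot>\<^bsub>Q\<^esub> q)" unfolding r(2) by simp
  qed
  finally show ?thesis .
qed

end

section \<open>Transport of the structure of \<open>[0, a]\<close> along
  \<open>k_map\<close>\<close>

theorem theorem4p13:
  fixes Q :: "('q, 'm) quantale_struct_scheme"
    and arr :: "'q \<Rightarrow> 'q \<Rightarrow> 'u"
    and a :: 'q
  assumes "quantale Q" and "commutative_quantale Q" and "semicartesian_quantale Q"
    and "unital_quantale Q"
    and "a \<in> carrier Q"
  shows "quantale (Sub_quantale Q (representable Q arr a)) \<and>
    commutative_quantale (Sub_quantale Q (representable Q arr a)) \<and>
    semicartesian_quantale (Sub_quantale Q (representable Q arr a)) \<and>
    poset_iso (down_interval Q a) (Sub_quantale Q (representable Q arr a)) (k_map Q arr a) \<and>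
    quantale_iso (down_interval Q a) (Sub_quantale Q (representable Q arr a)) (k_map Q arr a)"
proof -
  interpret representable_sheaf Q arr a using assms(3,5) by unfold_locales
  note sc = down_interval_semicartesian_quantale[OF assms(3,5)]
  then have D: "quantale (down_interval Q a)" by (simp add: semicartesian_quantale_def)
  then have comm: "commutative_quantale (down_interval Q a)"
    using assms(2) unfolding commutative_quantale_def by simp
  have mult: "k_map Q arr a (x \<odot>\<^bsub>down_interval Q a\<^esub> y) =
      k_map Q arr a x \<odot>\<^bsub>Sub_quantale Q Y\<^esub> k_map Q arr a y"
    if "x \<in> carrier (down_interval Q a)" "y \<in> carrier (down_interval Q a)" for x y
    using sub_mult_k_map[OF that] by (simp add: Sub_quantale_def)
  note iso = k_map_poset_iso
  show ?thesis
    using iso poset_iso_quantale[OF iso D mult] poset_iso_commutative[OF iso comm mult]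
      poset_iso_semicartesian[OF iso sc mult] poset_iso_quantale_iso[OF iso D mult] by blast
qed

end
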